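(* There is a constant $C_\Phi>0$ such that, for every regular integral weight $\lambda\in\mathfrak t^*$ and every $H\in\mathfrak t$, $$|A_\lambda^\Phi(H)|\le C_\Phi\sum_{w\in W}\ \prod_{\alpha\in\Phi^+}\min\bigl\{1,\ d_\alpha(H)\,|\langle w\lambda,\alpha^\vee\rangle|\bigr\}.$$
   Context: $U$ is a compact connected semisimple Lie group, $T$ a maximal torus, $\mathfrak t$ its Lie algebra with a Weyl-group-invariant inner product $\langle\cdot,\cdot\rangle$ (transported to $\mathfrak t^*$), and $\Phi\subset\mathfrak t^*$ the root system of $(U,T)$, with roots taken real-valued on $\mathfrak t$ (so that the root characters of $T$ are $\exp H\mapsto e^{i\alpha(H)}$). $\Phi^+$ is a positive system, $W$ the Weyl group, $\alpha^\vee=2\alpha/\langle\alpha,\alpha\rangle$. The Weyl alternant is $A_\lambda^\Phi(H)=\sum_{w\in W}\det(w)e^{i\langle w\lambda,H\rangle}$, where $\langle\lambda,H\rangle=\lambda(H)$. For $\alpha\in\Phi$ and $H\in\mathfrak t$, $d_\alpha(H)=|\sin(\alpha(H)/2)|$. A weight $\lambda\in\mathfrak t^*$ is regular integral if $\langle\lambda,\alpha^\vee\rangle\in\mathbb Z\setminus\{0\}$ for every root $\alpha\in\Phi$. *)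

theory Defs
  imports "HOL-Analysis.Analysis"
begin

(* The Lie algebra t of the maximal torus is real ^ 'n, where 'n indexes an orthonormal basis
   for the chosen Weyl-invariant inner product.  The dual t* carries the transported inner
   product, i.e. it is identified with t so that a weight \<mu> takes the value \<mu> \<bullet> H at H.
   The group (U,T) enters only through its root system: as an input, a reduced crystallographic
   root system that spans t* because U is semisimple. *)

definition coroot :: "real ^ 'n \<Rightarrow> real ^ 'n" where
  "coroot \<alpha> = (2 / (\<alpha> \<bullet> \<alpha>)) *\<^sub>R \<alpha>"

definition reflection :: "real ^ 'n \<Rightarrow> real ^ 'n \<Rightarrow> real ^ 'n" where
  "reflection \<alpha> v = v - (v \<bullet> coroot \<alpha>) *\<^sub>R \<alpha>"

definition root_system :: "(real ^ 'n) set \<Rightarrow> bool" where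
  "root_system \<Phi> \<longleftrightarrow>
     finite \<Phi> \<and> 0 \<notin> \<Phi> \<and> span \<Phi> = UNIV \<and>
     (\<forall>\<alpha>\<in>\<Phi>. reflection \<alpha> ` \<Phi> = \<Phi>) \<and>
     (\<forall>\<alpha>\<in>\<Phi>. \<forall>\<beta>\<in>\<Phi>. \<beta> \<bullet> coroot \<alpha> \<in> \<int>) \<and>
     (\<forall>\<alpha>\<in>\<Phi>. \<forall>c. c *\<^sub>R \<alpha> \<in> \<Phi> \<longrightarrow> c = 1 \<or> c = -1)"

definition positive_system :: "(real ^ 'n) set \<Rightarrow> (real ^ 'n) set \<Rightarrow> bool" where
  "positive_system \<Phi> P \<longleftrightarrow>
     P \<subseteq> \<Phi> \<and>
     (\<forall>\<alpha>\<in>\<Phi>. (\<alpha> \<in> P) \<noteq> (-\<alpha> \<in> P)) \<and>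
     (\<forall>\<alpha>\<in>P. \<forall>\<beta>\<in>P. \<alpha> + \<beta> \<in> \<Phi> \<longrightarrow> \<alpha> + \<beta> \<in> P)"

(* Reflections are involutions, so closing the identity under left multiplication by them
   yields the generated group. *)
inductive_set weyl_group :: "(real ^ 'n) set \<Rightarrow> (real ^ 'n \<Rightarrow> real ^ 'n) set"
  for \<Phi> :: "(real ^ 'n) set" where
  weyl_id: "id \<in> weyl_group \<Phi>"
| weyl_reflection: "\<alpha> \<in> \<Phi> \<Longrightarrow> w \<in> weyl_group \<Phi> \<Longrightarrow> reflection \<alpha> \<circ> w \<in> weyl_group \<Phi>"

definition weyl_alternant :: "(real ^ 'n) set \<Rightarrow> real ^ 'n \<Rightarrow> real ^ 'n \<Rightarrow> complex" where
  "weyl_alternant \<Phi> \<mu> H =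
     (\<Sum>w\<in>weyl_group \<Phi>. of_real (det (matrix w)) * exp (\<i> * of_real (w \<mu> \<bullet> H)))"

definition root_dist :: "real ^ 'n \<Rightarrow> real ^ 'n \<Rightarrow> real" where
  "root_dist \<alpha> H = \<bar>sin ((\<alpha> \<bullet> H) / 2)\<bar>"

definition regular_integral :: "(real ^ 'n) set \<Rightarrow> real ^ 'n \<Rightarrow> bool" where
  "regular_integral \<Phi> \<mu> \<longleftrightarrow> (\<forall>\<alpha>\<in>\<Phi>. \<mu> \<bullet> coroot \<alpha> \<in> \<int> - {0})"

end

theory Submission
  imports Defs "HOL-Complex_Analysis.Complex_Analysis"
begin

text \<open>
  The alternant vanishes to first order on every wall, both as a function of \<open>H\<close> and as a
  function of \<open>\<mu>\<close>, and the estimate says that these two vanishing properties can be exploited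
  simultaneously, root by root.  The main work is a scale-invariant Euclidean estimate
  (\<open>euclidean_bound_exists\<close>): for every reflection-closed set \<open>\<Psi>\<close> of roots, with group \<open>W\<close>,
  the alternant \<open>A(\<lambda>, X) = (\<Sum>w\<in>W. det w * exp (\<i> * \<langle>w \<lambda>, X\<rangle>))\<close> is at most a constant times
  \<open>\<Sum>w\<in>W. \<Prod>\<alpha>>0. min 1 (\<bar>\<alpha>(X)\<bar> * \<bar>\<alpha>(w \<lambda>)\<bar>)\<close>.  It is proved for complex \<open>\<lambda>\<close> whose
  imaginary part stays bounded against the orbit of \<open>X\<close>; this freedom is what makes the induction close.

  The induction is on the size of \<open>\<Psi>\<close>.  Put \<open>R = max \<bar>\<alpha>(X)\<bar>\<close>, let \<open>J\<close> be the roots with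
  \<open>\<bar>\<alpha>(X)\<bar>\<close> small compared with \<open>R\<close>, and let \<open>K\<close> be the roots with \<open>\<bar>\<alpha>(\<lambda>)\<bar>\<close> small compared with
  \<open>1 / R\<close>.  If the two thresholds lie in a gap of the finitely many values
  (\<open>threshold_gap\<close>), then \<open>J\<close> and \<open>K\<close> are again reflection-closed, and \<open>J\<close> is proper because the
  maximum is attained.  Split \<open>A\<close> into the sums \<open>G\<close> over the double cosets of the groups of \<open>J\<close>
  and \<open>K\<close>.  As a function of \<open>\<lambda>\<close>, \<open>G\<close> is entire and vanishes on the hyperplanes \<open>\<beta>(\<lambda>) = 0\<close> with
  \<open>\<beta>\<close> in \<open>K\<close>, so a Schwarz lemma along a generic complex line (\<open>division_by_roots\<close>) gives
  \<open>\<bar>G(\<lambda>)\<bar> \<le> (\<Prod>\<beta>\<in>K \<inter> P. R * \<bar>\<beta>(\<lambda>)\<bar>) * sup \<bar>G\<bar>\<close>, with a supremum over shifts of \<open>\<lambda>\<close> of size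
  \<open>O(1 / R)\<close>.  For each shifted point, \<open>G\<close> is a signed sum of alternants of \<open>J\<close>, to which the induction
  hypothesis applies.  That the product of the two bounds is dominated by the desired one can
  be checked one root at a time (\<open>factor_comparison\<close>, \<open>comparison_product\<close>): roots outside \<open>J\<close>
  have \<open>\<bar>\<alpha>(X)\<bar>\<close> of order \<open>R\<close>, and roots outside \<open>K\<close> have \<open>\<bar>\<alpha>(\<lambda>)\<bar>\<close> at least of order \<open>1 / R\<close>.

  To return to the torus, let \<open>J\<close> be the roots with small \<open>root_dist\<close>, again cut off at a gap.  The
  representatives of \<open>\<alpha>(H)\<close> modulo \<open>2 * pi\<close> that are closest to zero satisfy the reflection relations exactly,
  hence have the form \<open>\<alpha>(X)\<close> for one vector \<open>X\<close> (\<open>reflection_cocycle_linear\<close>).  For integral \<open>\<mu>\<close> the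
  alternant of \<open>J\<close> has the same modulus at \<open>H\<close> and at \<open>X\<close>, and the Euclidean estimate applies.  Every root outside \<open>J\<close>
  contributes a factor bounded below, since \<open>\<bar>\<langle>w \<mu>, \<alpha>\<^sup>\<or>\<rangle>\<bar> \<ge> 1\<close> for regular integral \<open>\<mu>\<close>.
\<close>

section \<open>Reflections\<close>

lemma inner_coroot: "v \<bullet> coroot \<alpha> = 2 * (v \<bullet> \<alpha>) / (\<alpha> \<bullet> \<alpha>)"
  by (simp add: coroot_def)

lemma linear_reflection: "linear (reflection \<alpha>)"
  by (rule linearI) (simp_all add: reflection_def inner_add_left algebra_simps)

lemma inner_reflection:
  "reflection \<alpha> v \<bullet> u = v \<bullet> u - 2 * (v \<bullet> \<alpha>) * (u \<bullet> \<alpha>) / (\<alpha> \<bullet> \<alpha>)"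
  by (simp add: reflection_def inner_coroot inner_diff_left inner_commute[of \<alpha> u])

lemma inner_reflection_commute: "reflection \<alpha> v \<bullet> u = v \<bullet> reflection \<alpha> u"
  unfolding inner_commute[of v] inner_reflection by (simp add: inner_commute)

lemma reflection_involution: "reflection \<alpha> (reflection \<alpha> v) = v"
proof (cases "\<alpha> = 0")
  case False
  have "reflection \<alpha> v \<bullet> coroot \<alpha> = - (v \<bullet> coroot \<alpha>)"
    using False by (simp add: reflection_def inner_diff_left) (simp add: coroot_def)
  then show ?thesis
    by (simp add: reflection_def[of \<alpha> "reflection \<alpha> v"]) (simp add: reflection_def)
qed (simp add: reflection_def)

lemma orthogonal_transformation_reflection: "orthogonal_transformation (reflection \<alpha>)"
  unfolding orthogonal_transformation_def
  by (simp add: linear_reflection inner_reflection_commute reflection_involution)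

lemma reflection_self: "reflection \<alpha> \<alpha> = - \<alpha>"
proof (cases "\<alpha> = 0")
  case False
  then have "\<alpha> \<bullet> coroot \<alpha> = 2" by (simp add: inner_coroot)
  then show ?thesis by (simp add: reflection_def scaleR_2)
qed (simp add: reflection_def)

lemma reflection_fixes: "\<alpha> \<bullet> v = 0 \<Longrightarrow> reflection \<alpha> v = v"
  by (simp add: reflection_def inner_coroot inner_commute)

lemma orthogonal_reflection:
  assumes "orthogonal_transformation f"
  shows "f (reflection \<alpha> v) = reflection (f \<alpha>) (f v)"
  using assms
  by (simp add: reflection_def inner_coroot linear_diff linear_scale orthogonal_transformation_def)

lemma det_compose:
  fixes f g :: "real ^ 'n \<Rightarrow> real ^ 'n"
  assumes "linear f" "linear g"
  shows "det (matrix (f \<circ> g)) = det (matrix f) * det (matrix g)"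
  using assms by (simp add: matrix_compose det_mul)

text \<open>The determinant is invariant under orthogonal conjugation, so it may be computed for a
  vector on a coordinate axis, whose reflection is a diagonal matrix.\<close>

lemma det_reflection:
  fixes \<alpha> :: "real ^ 'n"
  assumes "\<alpha> \<noteq> 0"
  shows "det (matrix (reflection \<alpha>)) = - 1"
proof -
  obtain k :: 'n where True by simp
  define e :: "real ^ 'n" where "e = axis k (norm \<alpha>)"
  have e: "axis j 1 \<bullet> e = (if j = k then norm \<alpha> else 0)"
    "e $ j = (if j = k then norm \<alpha> else 0)" for j
    by (auto simp: e_def inner_axis_axis) (auto simp: axis_def)
  have ee: "e \<bullet> e = norm \<alpha> * norm \<alpha>" by (simp add: e_def inner_axis_axis)
  have entry: "matrix (reflection e) $ i $ j = (if i = j then if i = k then -1 else 1 else 0)" for i j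
    using assms by (simp add: matrix_def reflection_def inner_coroot e ee) (auto simp: axis_def)
  have "norm \<alpha> = norm e" by (simp add: e_def norm_eq_sqrt_inner inner_axis_axis)
  then obtain f where f: "orthogonal_transformation f" "f \<alpha> = e"
    using orthogonal_transformation_exists by blast
  have lf: "linear f" using f(1) by (rule orthogonal_transformation_linear)
  have "f \<circ> reflection \<alpha> = reflection e \<circ> f"
    using orthogonal_reflection[OF f(1)] f(2) by auto
  then have "det (matrix f) * det (matrix (reflection \<alpha>)) = det (matrix (reflection e)) * det (matrix f)"
    by (metis det_compose lf linear_reflection)
  moreover have "det (matrix f) \<noteq> 0" using orthogonal_transformation_det[OF f(1)] by auto
  ultimately have "det (matrix (reflection \<alpha>)) = det (matrix (reflection e))" by simp
  also have "\<dots> = (\<Prod>i\<in>UNIV. matrix (reflection e) $ i $ i)"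
    by (rule det_diagonal) (simp add: entry)
  also have "\<dots> = (\<Prod>i\<in>UNIV. if i = k then -1 else 1)"
    by (rule prod.cong) (simp_all add: entry)
  also have "\<dots> = - 1" by simp
  finally show ?thesis .
qed

section \<open>The reflection group of a reflection-closed set\<close>

definition reflection_closed :: "(real ^ 'n) set \<Rightarrow> bool" where
  "reflection_closed \<Psi> \<longleftrightarrow> 0 \<notin> \<Psi> \<and> (\<forall>\<alpha>\<in>\<Psi>. \<forall>\<beta>\<in>\<Psi>. reflection \<alpha> \<beta> \<in> \<Psi>)"

lemma weyl_orthogonal: "w \<in> weyl_group \<Psi> \<Longrightarrow> orthogonal_transformation w"
proof (induction rule: weyl_group.induct)
  case weyl_id
  show ?case by (simp add: id_def)
next
  case (weyl_reflection \<alpha> w)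
  then show ?case
    by (intro orthogonal_transformation_compose orthogonal_transformation_reflection)
qed

lemma weyl_linear: "w \<in> weyl_group \<Psi> \<Longrightarrow> linear w"
  using weyl_orthogonal orthogonal_transformation_linear by blast

lemma weyl_reflection_mem: "\<alpha> \<in> \<Psi> \<Longrightarrow> reflection \<alpha> \<in> weyl_group \<Psi>"
  using weyl_group.weyl_reflection[OF _ weyl_group.weyl_id] by fastforce

lemma weyl_comp:
  assumes "u \<in> weyl_group \<Psi>" "w \<in> weyl_group \<Psi>"
  shows "u \<circ> w \<in> weyl_group \<Psi>"
  using assms(1)
proof (induction rule: weyl_group.induct)
  case weyl_id
  then show ?case using assms(2) by simp
next
  case (weyl_reflection \<alpha> u)
  then show ?case
    unfolding comp_assoc by (intro weyl_group.weyl_reflection)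
qed

lemma weyl_inverse:
  assumes "w \<in> weyl_group \<Psi>"
  shows "\<exists>u\<in>weyl_group \<Psi>. u \<circ> w = id \<and> w \<circ> u = id"
  using assms
proof (induction rule: weyl_group.induct)
  case weyl_id
  show ?case using weyl_group.weyl_id[of \<Psi>] by (intro bexI[of _ id]) auto
next
  case (weyl_reflection \<alpha> w)
  then obtain u where u: "u \<in> weyl_group \<Psi>" "u \<circ> w = id" "w \<circ> u = id" by blast
  have "u \<circ> reflection \<alpha> \<in> weyl_group \<Psi>"
    using u(1) weyl_reflection(1) by (intro weyl_comp weyl_reflection_mem)
  moreover have "(u \<circ> reflection \<alpha>) \<circ> (reflection \<alpha> \<circ> w) = id"
    "(reflection \<alpha> \<circ> w) \<circ> (u \<circ> reflection \<alpha>) = id"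
    using u(2,3) by (auto simp: fun_eq_iff reflection_involution)
  ultimately show ?case by blast
qed

lemma weyl_mono: "\<Psi> \<subseteq> \<Phi> \<Longrightarrow> weyl_group \<Psi> \<subseteq> weyl_group \<Phi>"
proof
  fix w assume "\<Psi> \<subseteq> \<Phi>" "w \<in> weyl_group \<Psi>"
  from this(2,1) show "w \<in> weyl_group \<Phi>"
    by (induction rule: weyl_group.induct) (auto intro: weyl_group.intros)
qed

lemma weyl_maps_roots:
  assumes "reflection_closed \<Psi>" "w \<in> weyl_group \<Psi>" "\<beta> \<in> \<Psi>"
  shows "w \<beta> \<in> \<Psi>"
  using assms(2,3,1) by (induction arbitrary: rule: weyl_group.induct) (auto simp: reflection_closed_def)

lemma weyl_bij_betw_left:
  assumes "u \<in> weyl_group \<Psi>"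
  shows "bij_betw (\<lambda>w. u \<circ> w) (weyl_group \<Psi>) (weyl_group \<Psi>)"
proof -
  obtain v where v: "v \<in> weyl_group \<Psi>" "v \<circ> u = id" "u \<circ> v = id"
    using weyl_inverse[OF assms] by blast
  then show ?thesis
    using weyl_comp assms
    by (intro bij_betw_byWitness[where f' = "\<lambda>w. v \<circ> w"]) (auto simp flip: comp_assoc)
qed

lemma weyl_bij_betw_right:
  assumes "u \<in> weyl_group \<Psi>"
  shows "bij_betw (\<lambda>w. w \<circ> u) (weyl_group \<Psi>) (weyl_group \<Psi>)"
proof -
  obtain v where v: "v \<in> weyl_group \<Psi>" "v \<circ> u = id" "u \<circ> v = id"
    using weyl_inverse[OF assms] by blast
  then show ?thesis
    using weyl_comp assms
    by (intro bij_betw_byWitness[where f' = "\<lambda>w. w \<circ> v"]) (auto simp: comp_assoc)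
qed

lemma abs_det_weyl: "w \<in> weyl_group \<Psi> \<Longrightarrow> \<bar>det (matrix w)\<bar> = 1"
  using weyl_orthogonal by (simp add: weyl_orthogonal)

text \<open>The roots span, so an element of the group is determined by the way it permutes them.\<close>

lemma finite_weyl_group:
  fixes \<Phi> :: "(real ^ 'n) set"
  assumes "finite \<Phi>" "reflection_closed \<Phi>" "span \<Phi> = UNIV"
  shows "finite (weyl_group \<Phi>)"
proof -
  have "inj_on (\<lambda>w. restrict w \<Phi>) (weyl_group \<Phi>)"
  proof (rule inj_onI)
    fix u w assume uw: "u \<in> weyl_group \<Phi>" "w \<in> weyl_group \<Phi>" "restrict u \<Phi> = restrict w \<Phi>"
    have "\<And>x. x \<in> \<Phi> \<Longrightarrow> u x = w x" using uw(3) by (metis restrict_apply')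
    then have "u x = w x" for x
      using linear_eq_on_span[OF weyl_linear[OF uw(1)] weyl_linear[OF uw(2)]] assms(3) by blast
    then show "u = w" by blast
  qed
  moreover have "(\<lambda>w. restrict w \<Phi>) ` weyl_group \<Phi> \<subseteq> (\<Phi> \<rightarrow>\<^sub>E \<Phi>)"
    using weyl_maps_roots[OF assms(2)] by auto
  ultimately show ?thesis
    using assms(1) by (meson finite_PiE finite_imageD finite_subset)
qed

section \<open>Zeros, generic directions and gaps\<close>

text \<open>A real vector space is not a finite union of proper subspaces.\<close>

lemma avoid_orthogonal_hyperplanes:
  fixes V S :: "'a::real_inner set"
  assumes "subspace V" "finite S" "S \<subseteq> V - {0}"
  shows "\<exists>v\<in>V. \<forall>s\<in>S. s \<bullet> v \<noteq> 0"
  using assms(2,3)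
proof (induction S)
  case empty
  then show ?case using subspace_0[OF assms(1)] by blast
next
  case (insert s S)
  then obtain v where v: "v \<in> V" "\<And>r. r \<in> S \<Longrightarrow> r \<bullet> v \<noteq> 0" by auto
  \<comment> \<open>values of \<open>\<tau>\<close> for which \<open>v + \<tau> *\<^sub>R s\<close> falls into one of the hyperplanes\<close>
  define bad where "bad = insert (- (s \<bullet> v) / (s \<bullet> s)) ((\<lambda>r. - (r \<bullet> v) / (r \<bullet> s)) ` S)"
  have "finite bad" using insert.hyps by (simp add: bad_def)
  then obtain \<tau> :: real where \<tau>: "\<tau> \<notin> bad"
    using ex_new_if_finite infinite_UNIV_char_0 by blast
  have "r \<bullet> (v + \<tau> *\<^sub>R s) \<noteq> 0" if "r \<in> insert s S" for r
  proof (cases "r \<bullet> s = 0")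
    case True
    then show ?thesis using that insert.prems v(2)[of r] by (auto simp: inner_add_right)
  next
    case False
    have "\<tau> \<noteq> - (r \<bullet> v) / (r \<bullet> s)" using \<tau> that by (auto simp: bad_def)
    with False show ?thesis by (auto simp: inner_add_right field_simps)
  qed
  moreover have "v + \<tau> *\<^sub>R s \<in> V"
    using insert.prems v(1) assms(1) by (auto intro!: subspace_add subspace_scale)
  ultimately show ?case by blast
qed

text \<open>The division of an entire function by one of its zeros costs a factor \<open>1 / (2 * r)\<close> on the
  circle of radius \<open>3 * r\<close>, and the maximum principle carries this bound into the disc.\<close>

lemma entire_bound_from_zeros:
  fixes g :: "complex \<Rightarrow> complex"
  assumes "finite I" and "g holomorphic_on UNIV" and "r > 0"
    and "inj_on \<zeta> I" and "\<And>i. i \<in> I \<Longrightarrow> g (\<zeta> i) = 0" and "\<And>i. i \<in> I \<Longrightarrow> cmod (\<zeta> i) \<le> r"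
    and "\<And>z. cmod z \<le> 3 * r \<Longrightarrow> cmod (g z) \<le> B"
  shows "cmod (g 0) \<le> (\<Prod>i\<in>I. cmod (\<zeta> i) / (2 * r)) * B"
  using assms(1,2,4-)
proof (induction I arbitrary: g B)
  case empty
  then show ?case using \<open>r > 0\<close> by simp
next
  case (insert j I)
  define h where "h = (\<lambda>z. if z = \<zeta> j then deriv g (\<zeta> j) else (g z - g (\<zeta> j)) / (z - \<zeta> j))"
  have hol: "h holomorphic_on UNIV"
    unfolding h_def by (rule pole_lemma) (use insert.prems in auto)
  have gj: "g (\<zeta> j) = 0" using insert.prems by auto
  have gh: "g z = (z - \<zeta> j) * h z" for z using gj by (simp add: h_def)
  have sphere: "cmod (h z) \<le> B / (2 * r)" if "cmod z = 3 * r" for z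
  proof -
    have "cmod (z - \<zeta> j) \<ge> 2 * r"
      using norm_triangle_ineq2[of z "\<zeta> j"] that insert.prems(4)[of j] by simp
    moreover have "cmod (z - \<zeta> j) * cmod (h z) \<le> B"
      using insert.prems(5)[of z] that by (simp add: gh norm_mult)
    ultimately have "2 * r * cmod (h z) \<le> B"
      by (meson mult_right_mono norm_ge_zero order_trans)
    then show ?thesis using \<open>r > 0\<close> by (simp add: field_simps)
  qed
  have disc: "cmod (h z) \<le> B / (2 * r)" if "cmod z \<le> 3 * r" for z
  proof (rule maximum_modulus_frontier[where S = "cball 0 (3 * r)" and f = h])
    show "h holomorphic_on interior (cball 0 (3 * r))"
      using hol holomorphic_on_subset by blast
    show "continuous_on (closure (cball 0 (3 * r))) h"
      using hol holomorphic_on_imp_continuous_on continuous_on_subset by blast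
  qed (use that sphere \<open>r > 0\<close> in \<open>auto simp: frontier_cball dist_norm\<close>)
  have "cmod (h 0) \<le> (\<Prod>i\<in>I. cmod (\<zeta> i) / (2 * r)) * (B / (2 * r))"
  proof (rule insert.IH[OF hol])
    show "h (\<zeta> i) = 0" if "i \<in> I" for i
    proof -
      have "\<zeta> i \<noteq> \<zeta> j" using that insert.prems(2) insert.hyps(2) by (auto simp: inj_on_def)
      moreover have "g (\<zeta> i) = 0" using that insert.prems(3) by simp
      ultimately show ?thesis using gh[of "\<zeta> i"] by simp
    qed
  qed (use insert.prems disc in auto)
  then have "cmod (\<zeta> j) * cmod (h 0)
      \<le> cmod (\<zeta> j) * ((\<Prod>i\<in>I. cmod (\<zeta> i) / (2 * r)) * (B / (2 * r)))"
    by (rule mult_left_mono) simp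
  then show ?case
    using insert.hyps by (simp add: gh norm_mult field_simps)
qed

text \<open>Pigeonhole: the \<open>m + 1\<close> half-open intervals between consecutive powers
  \<open>1 / q ^ k\<close> cannot all contain one of \<open>m\<close> values.\<close>

lemma threshold_gap:
  fixes f :: "'a \<Rightarrow> real"
  assumes "finite S" "card S \<le> m" "q > 1"
  shows "\<exists>\<theta>. 1 / q ^ (m + 1) \<le> \<theta> \<and> \<theta> \<le> 1 / q \<and> (\<forall>x\<in>S. f x \<le> q * \<theta> \<longrightarrow> f x \<le> \<theta>)"
proof (rule ccontr)
  assume none: "\<not> ?thesis"
  define L where "L k = {x \<in> S. f x \<le> 1 / q ^ k}" for k
  have strict: "card (L (Suc k)) < card (L k)" if "k \<le> m" for k
  proof (rule psubset_card_mono)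
    show "finite (L k)" using assms(1) by (simp add: L_def)
    have pow: "1 / q ^ Suc k \<le> 1 / q ^ k" "1 / q ^ (m + 1) \<le> 1 / q ^ Suc k" "1 / q ^ Suc k \<le> 1 / q"
      using assms(3) that by (auto intro!: divide_left_mono power_increasing self_le_power)
    then obtain x where "x \<in> S" "f x \<le> q * (1 / q ^ Suc k)" "\<not> f x \<le> 1 / q ^ Suc k"
      using none by blast
    then have "x \<in> L k - L (Suc k)" using assms(3) by (simp add: L_def)
    moreover have "L (Suc k) \<subseteq> L k" using pow(1) by (auto simp: L_def)
    ultimately show "L (Suc k) \<subset> L k" by blast
  qed
  have "card (L k) + k \<le> m" if "k \<le> m + 1" for k
    using that
  proof (induction k)
    case 0
    have "card (L 0) \<le> card S" using assms(1) by (intro card_mono) (auto simp: L_def)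
    then show ?case using assms(2) by simp
  next
    case (Suc k)
    then show ?case using strict[of k] by simp
  qed
  from this[of "m + 1"] show False by simp
qed

text \<open>A common constant for finitely many bounds that weaken as the constant grows.\<close>

lemma uniform_constant:
  fixes Q :: "'a \<Rightarrow> real \<Rightarrow> bool"
  assumes "finite S" "\<And>x. x \<in> S \<Longrightarrow> \<exists>C. Q x C" "\<And>x C D. Q x C \<Longrightarrow> C \<le> D \<Longrightarrow> Q x D"
  shows "\<exists>C\<ge>0. \<forall>x\<in>S. Q x C"
  using assms(1,2)
proof (induction S)
  case (insert y S)
  then obtain C D where "C \<ge> 0" "\<forall>x\<in>S. Q x C" "Q y D" by (metis insert_iff)
  then have "max C D \<ge> 0 \<and> (\<forall>x\<in>insert y S. Q x (max C D))"
    using assms(3) by (metis insert_iff max.cobounded1 max.cobounded2 order_trans)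
  then show ?case by blast
qed auto

section \<open>Alternants with complex spectral parameter\<close>

text \<open>A complex spectral parameter is carried as its real part \<open>a\<close> and imaginary part \<open>b\<close>; \<open>cpair x a b\<close> is
  the complex-linear extension of \<open>x \<bullet> _\<close> evaluated at \<open>a + \<i> b\<close>.\<close>

definition cpair :: "real ^ 'n \<Rightarrow> real ^ 'n \<Rightarrow> real ^ 'n \<Rightarrow> complex" where
  "cpair x a b = Complex (x \<bullet> a) (x \<bullet> b)"

definition alternant :: "(real ^ 'n) set \<Rightarrow> real ^ 'n \<Rightarrow> real ^ 'n \<Rightarrow> real ^ 'n \<Rightarrow> complex" where
  "alternant \<Psi> a b X =
     (\<Sum>w\<in>weyl_group \<Psi>. of_real (det (matrix w)) * exp (\<i> * cpair X (w a) (w b)))"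

text \<open>Moving \<open>(a, b)\<close> by \<open>(Re z, Im z)\<close> times a real vector \<open>v\<close> is moving along the complex line through
  \<open>a + \<i> b\<close> in the direction \<open>v\<close>.\<close>

lemma cpair_line:
  "cpair x (a + Re z *\<^sub>R v) (b + Im z *\<^sub>R v) = cpair x a b + z * of_real (x \<bullet> v)"
  by (simp add: cpair_def complex_eq_iff inner_add_right)

lemma cpair_weyl_line:
  assumes "linear w"
  shows "cpair x (w (a + Re z *\<^sub>R v)) (w (b + Im z *\<^sub>R v)) = cpair x (w a) (w b) + z * of_real (x \<bullet> w v)"
  by (simp add: linear_add[OF assms] linear_scale[OF assms] cpair_line)

lemma cpair_orthogonal:
  assumes "orthogonal_transformation w"
  shows "cpair (w x) (w a) (w b) = cpair x a b"
  using assms by (simp add: cpair_def orthogonal_transformation_def)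

lemma cpair_uminus: "cpair (- x) a b = - cpair x a b"
  by (simp add: cpair_def complex_eq_iff)

lemma cpair_eq_0_iff: "cpair x a b = 0 \<longleftrightarrow> x \<bullet> a = 0 \<and> x \<bullet> b = 0"
  by (simp add: cpair_def complex_eq_iff)

lemma holomorphic_alternant_line:
  assumes "linear u"
  shows "(\<lambda>z. alternant \<Psi> (u (a + Re z *\<^sub>R v)) (u (b + Im z *\<^sub>R v)) X) holomorphic_on UNIV"
proof -
  have "(\<lambda>z. \<Sum>w\<in>weyl_group \<Psi>. of_real (det (matrix w))
          * exp (\<i> * (cpair X (w (u a)) (w (u b)) + z * of_real (X \<bullet> w (u v))))) holomorphic_on UNIV"
    by (intro holomorphic_intros)
  moreover have "cpair X (w (u (a + Re z *\<^sub>R v))) (w (u (b + Im z *\<^sub>R v)))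
      = cpair X (w (u a)) (w (u b)) + z * of_real (X \<bullet> w (u v))" if "w \<in> weyl_group \<Psi>" for w z
    using cpair_weyl_line[of "w \<circ> u" X a z v b] linear_compose[OF assms weyl_linear[OF that]] by simp
  ultimately show ?thesis by (simp add: alternant_def)
qed

text \<open>A sign-reversing bijection that preserves the summands cancels the sum.\<close>

lemma alternating_sum_eq_0:
  fixes F :: "'a \<Rightarrow> complex" and e :: "'a \<Rightarrow> real"
  assumes "bij_betw h W W" "\<And>w. w \<in> W \<Longrightarrow> e (h w) = - e w" "\<And>w. w \<in> W \<Longrightarrow> F (h w) = F w"
  shows "(\<Sum>w\<in>W. of_real (e w) * F w) = 0"
proof -
  have "(\<Sum>w\<in>W. of_real (e w) * F w) = (\<Sum>w\<in>W. of_real (e (h w)) * F (h w))"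
    using sum.reindex_bij_betw[OF assms(1), of "\<lambda>w. of_real (e w) * F w"] by simp
  also have "\<dots> = - (\<Sum>w\<in>W. of_real (e w) * F w)"
    using assms(2,3) by (simp flip: sum_negf)
  finally show ?thesis by simp
qed

lemma weyl_sum_right_invariant:
  assumes "\<beta> \<in> \<Psi>" "\<beta> \<noteq> 0"
    and "\<And>w. w \<in> weyl_group \<Psi> \<Longrightarrow> F (w \<circ> reflection \<beta>) = F w"
  shows "(\<Sum>w\<in>weyl_group \<Psi>. of_real (det (matrix w)) * F w) = (0::complex)"
proof (rule alternating_sum_eq_0[OF weyl_bij_betw_right[OF weyl_reflection_mem[OF assms(1)]]])
  fix w assume w: "w \<in> weyl_group \<Psi>"
  show "det (matrix (w \<circ> reflection \<beta>)) = - det (matrix w)"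
    by (simp add: det_compose[OF weyl_linear[OF w] linear_reflection] det_reflection assms(2))
qed (rule assms(3))

lemma weyl_sum_left_invariant:
  assumes "\<beta> \<in> \<Psi>" "\<beta> \<noteq> 0"
    and "\<And>w. w \<in> weyl_group \<Psi> \<Longrightarrow> F (reflection \<beta> \<circ> w) = F w"
  shows "(\<Sum>w\<in>weyl_group \<Psi>. of_real (det (matrix w)) * F w) = (0::complex)"
proof (rule alternating_sum_eq_0[OF weyl_bij_betw_left[OF weyl_reflection_mem[OF assms(1)]]])
  fix w assume w: "w \<in> weyl_group \<Psi>"
  show "det (matrix (reflection \<beta> \<circ> w)) = - det (matrix w)"
    by (simp add: det_compose[OF linear_reflection weyl_linear[OF w]] det_reflection assms(2))
qed (rule assms(3))

lemma alternant_eq_0_spectral: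
  assumes "\<beta> \<in> \<Psi>" "\<beta> \<noteq> 0" "cpair \<beta> a b = 0"
  shows "alternant \<Psi> a b X = 0"
  unfolding alternant_def using assms
  by (intro weyl_sum_right_invariant[of \<beta>]) (simp_all add: cpair_eq_0_iff reflection_fixes)

lemma alternant_eq_0_spatial:
  assumes "\<beta> \<in> \<Psi>" "\<beta> \<noteq> 0" "\<beta> \<bullet> X = 0"
  shows "alternant \<Psi> a b X = 0"
  unfolding alternant_def
proof (intro weyl_sum_left_invariant[of \<beta>] assms)
  fix w
  have "X \<bullet> reflection \<beta> y = X \<bullet> y" for y
    using reflection_fixes[OF assms(3)] by (metis inner_reflection_commute)
  then show "exp (\<i> * cpair X ((reflection \<beta> \<circ> w) a) ((reflection \<beta> \<circ> w) b)) = exp (\<i> * cpair X (w a) (w b))"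
    by (simp add: cpair_def)
qed

lemma weyl_sum_two_sided:
  assumes "j \<in> weyl_group \<Psi>" "k \<in> weyl_group \<Psi>"
  shows "(\<Sum>w\<in>weyl_group \<Psi>. f (j \<circ> w \<circ> k)) = (\<Sum>w\<in>weyl_group \<Psi>. f w)"
proof -
  have "(\<Sum>w\<in>weyl_group \<Psi>. f (j \<circ> w \<circ> k)) = (\<Sum>w\<in>weyl_group \<Psi>. f (w \<circ> k))"
    using sum.reindex_bij_betw[OF weyl_bij_betw_left[OF assms(1)], of "\<lambda>w. f (w \<circ> k)"] by simp
  also have "\<dots> = (\<Sum>w\<in>weyl_group \<Psi>. f w)"
    using sum.reindex_bij_betw[OF weyl_bij_betw_right[OF assms(2)], of f] by simp
  finally show ?thesis .
qed

text \<open>Summing over \<open>j w k\<close> with all three factors varying runs through the group once for each pair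
  \<open>(j, k)\<close>.  This takes the place of a choice of double coset representatives.\<close>

lemma weyl_sum_double_coset:
  fixes f :: "(real ^ 'n \<Rightarrow> real ^ 'n) \<Rightarrow> 'b::semiring_1"
  assumes "J \<subseteq> \<Psi>" "K \<subseteq> \<Psi>"
  shows "(\<Sum>w\<in>weyl_group \<Psi>. \<Sum>k\<in>weyl_group K. \<Sum>j\<in>weyl_group J. f (j \<circ> w \<circ> k))
    = of_nat (card (weyl_group K)) * (of_nat (card (weyl_group J)) * (\<Sum>w\<in>weyl_group \<Psi>. f w))"
proof -
  have "(\<Sum>w\<in>weyl_group \<Psi>. \<Sum>k\<in>weyl_group K. \<Sum>j\<in>weyl_group J. f (j \<circ> w \<circ> k))
      = (\<Sum>k\<in>weyl_group K. \<Sum>j\<in>weyl_group J. \<Sum>w\<in>weyl_group \<Psi>. f (j \<circ> w \<circ> k))"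
    by (rule trans[OF sum.swap], rule sum.cong[OF refl], rule sum.swap)
  also have "\<dots> = (\<Sum>k\<in>weyl_group K. \<Sum>j\<in>weyl_group J. \<Sum>w\<in>weyl_group \<Psi>. f w)"
    by (rule sum.cong[OF refl], rule sum.cong[OF refl], rule weyl_sum_two_sided)
       (use weyl_mono[OF assms(1)] weyl_mono[OF assms(2)] in blast)+
  finally show ?thesis by simp
qed

text \<open>The inner sum is the part of the alternant that belongs to the double coset of \<open>w\<close>.  It is summed
  over all \<open>w\<close>, so the alternant and the majorant acquire the same multiplicity, which
  cancels: no constant is lost.\<close>

lemma alternant_bound_by_double_cosets:
  assumes fin: "finite (weyl_group \<Psi>)" and sub: "J \<subseteq> \<Psi>" "K \<subseteq> \<Psi>"
    and bound: "\<And>w. w \<in> weyl_group \<Psi> \<Longrightarrow>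
      cmod (\<Sum>k\<in>weyl_group K. of_real (det (matrix k)) * alternant J (w (k a)) (w (k b)) X)
        \<le> (\<Sum>k\<in>weyl_group K. \<Sum>j\<in>weyl_group J. M (j \<circ> w \<circ> k))"
  shows "cmod (alternant \<Psi> a b X) \<le> (\<Sum>w\<in>weyl_group \<Psi>. M w)"
proof -
  define n where "n = real (card (weyl_group K)) * real (card (weyl_group J))"
  have "finite (weyl_group K)" "finite (weyl_group J)"
    using weyl_mono sub fin by (meson finite_subset)+
  moreover have "weyl_group K \<noteq> {}" "weyl_group J \<noteq> {}" using weyl_group.weyl_id by blast+
  ultimately have n: "n > 0" by (simp add: n_def card_gt_0_iff)
  define f where "f w = complex_of_real (det (matrix w)) * exp (\<i> * cpair X (w a) (w b))" for w
  have "of_real n * alternant \<Psi> a b X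
      = (\<Sum>w\<in>weyl_group \<Psi>. \<Sum>k\<in>weyl_group K. \<Sum>j\<in>weyl_group J. f (j \<circ> w \<circ> k))"
    unfolding weyl_sum_double_coset[OF sub] by (simp add: n_def alternant_def f_def)
  also have "\<dots> = (\<Sum>w\<in>weyl_group \<Psi>. of_real (det (matrix w)) *
      (\<Sum>k\<in>weyl_group K. of_real (det (matrix k)) * alternant J (w (k a)) (w (k b)) X))"
    unfolding alternant_def sum_distrib_left
  proof (intro sum.cong refl)
    fix w k j assume w: "w \<in> weyl_group \<Psi>" "k \<in> weyl_group K" "j \<in> weyl_group J"
    have "det (matrix (j \<circ> w \<circ> k)) = det (matrix j) * det (matrix w) * det (matrix k)"
      using w by (simp add: det_compose linear_compose weyl_linear)
    then show "f (j \<circ> w \<circ> k) = of_real (det (matrix w)) * (of_real (det (matrix k)) *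
       (of_real (det (matrix j)) * exp (\<i> * cpair X (j (w (k a))) (j (w (k b))))))"
      by (simp add: f_def)
  qed
  also have "cmod \<dots> \<le> (\<Sum>w\<in>weyl_group \<Psi>. \<Sum>k\<in>weyl_group K. \<Sum>j\<in>weyl_group J. M (j \<circ> w \<circ> k))"
    using bound by (intro sum_norm_le) (simp add: norm_mult abs_det_weyl)
  also have "\<dots> = n * (\<Sum>w\<in>weyl_group \<Psi>. M w)"
    unfolding weyl_sum_double_coset[OF sub] by (simp add: n_def)
  finally show ?thesis using n by (simp add: norm_mult)
qed

lemma weyl_group_empty: "weyl_group {} = {id}"
proof -
  have "w = id" if "w \<in> weyl_group {}" for w :: "real ^ 'n \<Rightarrow> real ^ 'n"
    using that by (induction rule: weyl_group.induct) auto
  then show ?thesis using weyl_group.weyl_id by blast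
qed

section \<open>Division by the roots near the spectral parameter\<close>

locale positive_root_system =
  fixes \<Phi> P :: "(real ^ 'n) set"
  assumes root_system: "root_system \<Phi>" and positive_system: "positive_system \<Phi> P"
begin

lemma finite_roots: "finite \<Phi>" and zero_not_root: "0 \<notin> \<Phi>"
  using root_system by (auto simp: root_system_def)

lemma reflection_root: "\<alpha> \<in> \<Phi> \<Longrightarrow> \<beta> \<in> \<Phi> \<Longrightarrow> reflection \<alpha> \<beta> \<in> \<Phi>"
  using root_system by (auto simp: root_system_def)

lemma reflection_closed_roots: "reflection_closed \<Phi>"
  using zero_not_root reflection_root by (auto simp: reflection_closed_def)

lemma finite_weyl: "\<Psi> \<subseteq> \<Phi> \<Longrightarrow> finite (weyl_group \<Psi>)"
  using finite_weyl_group[OF finite_roots reflection_closed_roots] root_system weyl_mono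
  by (metis root_system_def finite_subset)

lemma closed_uminus: "reflection_closed \<Psi> \<Longrightarrow> \<alpha> \<in> \<Psi> \<Longrightarrow> - \<alpha> \<in> \<Psi>"
  by (metis reflection_closed_def reflection_self)

lemma uminus_positive: "\<alpha> \<in> P \<Longrightarrow> - \<alpha> \<notin> P" "\<alpha> \<in> \<Phi> \<Longrightarrow> \<alpha> \<notin> P \<Longrightarrow> - \<alpha> \<in> P"
  using positive_system by (auto simp: positive_system_def)

text \<open>Squaring turns a product over the positive roots of a set into a product over the whole set; this
  makes the transport of such products by group elements, which do not preserve positivity,
  immediate.\<close>

lemma prod_symmetric_set:
  fixes f :: "real ^ 'n \<Rightarrow> real"
  assumes "S \<subseteq> \<Phi>" "\<And>\<alpha>. \<alpha> \<in> S \<Longrightarrow> - \<alpha> \<in> S" "\<And>\<alpha>. \<alpha> \<in> S \<Longrightarrow> f (- \<alpha>) = f \<alpha>"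
  shows "(\<Prod>\<alpha>\<in>S. f \<alpha>) = (\<Prod>\<alpha>\<in>S \<inter> P. f \<alpha>)\<^sup>2"
proof -
  have S: "S = (S \<inter> P) \<union> uminus ` (S \<inter> P)"
    using assms(1,2) uminus_positive(2) by (force simp: image_iff)
  have fin: "finite (S \<inter> P)" using finite_roots assms(1) by (meson finite_Int finite_subset)
  have "(\<Prod>\<alpha>\<in>S. f \<alpha>) = (\<Prod>\<alpha>\<in>S \<inter> P. f \<alpha>) * (\<Prod>\<alpha>\<in>uminus ` (S \<inter> P). f \<alpha>)"
    by (subst S, rule prod.union_disjoint) (use fin uminus_positive(1) in auto)
  also have "(\<Prod>\<alpha>\<in>uminus ` (S \<inter> P). f \<alpha>) = (\<Prod>\<alpha>\<in>S \<inter> P. f \<alpha>)"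
    using assms(3) by (subst prod.reindex) (auto simp: inj_on_def)
  finally show ?thesis by (simp add: power2_eq_square)
qed

lemma prod_positive_weyl_image:
  fixes f g :: "real ^ 'n \<Rightarrow> real"
  assumes "K \<subseteq> \<Phi>" "reflection_closed K" "w \<in> weyl_group \<Phi>"
    and "\<And>\<beta>. \<beta> \<in> K \<Longrightarrow> g (w \<beta>) = f \<beta>" "\<And>\<beta>. f (- \<beta>) = f \<beta>" "\<And>\<beta>. f \<beta> \<ge> 0"
  shows "(\<Prod>\<beta>\<in>K \<inter> P. f \<beta>) = (\<Prod>\<alpha>\<in>w ` K \<inter> P. g \<alpha>)"
proof -
  have lin: "linear w" using assms(3) by (rule weyl_linear)
  have inj: "inj w" using weyl_orthogonal[OF assms(3)] by (rule orthogonal_transformation_inj)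
  have im: "w ` K \<subseteq> \<Phi>" using weyl_maps_roots[OF reflection_closed_roots assms(3)] assms(1) by auto
  have neg: "- \<alpha> \<in> w ` K \<and> g (- \<alpha>) = g \<alpha>" if \<alpha>: "\<alpha> \<in> w ` K" for \<alpha>
  proof -
    obtain \<beta> where \<beta>: "\<beta> \<in> K" "\<alpha> = w \<beta>" using \<alpha> by blast
    have "- \<alpha> = w (- \<beta>)" using \<beta>(2) linear_neg[OF lin] by simp
    then show ?thesis using closed_uminus[OF assms(2) \<beta>(1)] \<beta> assms(4,5) by (metis imageI)
  qed
  have "(\<Prod>\<beta>\<in>K \<inter> P. f \<beta>)\<^sup>2 = (\<Prod>\<beta>\<in>K. f \<beta>)"
    using closed_uminus[OF assms(2)] assms(1,5) by (intro prod_symmetric_set[symmetric]) auto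
  also have "\<dots> = (\<Prod>\<alpha>\<in>w ` K. g \<alpha>)"
    using inj assms(4) by (subst prod.reindex) (auto intro: inj_on_subset)
  also have "\<dots> = (\<Prod>\<alpha>\<in>w ` K \<inter> P. g \<alpha>)\<^sup>2"
    using neg im by (intro prod_symmetric_set) auto
  finally have "(\<Prod>\<beta>\<in>K \<inter> P. f \<beta>)\<^sup>2 = (\<Prod>\<alpha>\<in>w ` K \<inter> P. g \<alpha>)\<^sup>2" .
  moreover have "(\<Prod>\<beta>\<in>K \<inter> P. f \<beta>) \<ge> 0" using assms(6) by (simp add: prod_nonneg)
  moreover have "(\<Prod>\<alpha>\<in>w ` K \<inter> P. g \<alpha>) \<ge> 0" using assms(4,6) by (intro prod_nonneg) auto
  ultimately show ?thesis by (simp add: power2_eq_iff_nonneg)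
qed

text \<open>The direction has to avoid finitely many further hyperplanes \<open>S\<close>, which will depend on the
  spectral parameter, while the lower bound \<open>\<kappa>\<close> on the roots may not.  Hence a fixed direction
  avoiding the root hyperplanes is perturbed by an amount that is small in terms of \<open>S\<close>.  The coefficients
  with respect to \<open>\<Psi>\<close> are bounded so that pairings with \<open>v\<close> are controlled by pairings with roots.\<close>

lemma generic_direction:
  assumes "\<Psi> \<subseteq> \<Phi>"
  shows "\<exists>\<kappa>>0. \<forall>S. finite S \<and> S \<subseteq> span \<Psi> - {0} \<longrightarrow>
    (\<exists>t. (\<forall>\<beta>\<in>\<Psi>. \<bar>t \<beta>\<bar> \<le> 1) \<and> (\<forall>\<beta>\<in>\<Psi>. \<kappa> \<le> \<bar>\<beta> \<bullet> (\<Sum>\<gamma>\<in>\<Psi>. t \<gamma> *\<^sub>R \<gamma>)\<bar>) \<and>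
      (\<forall>s\<in>S. s \<bullet> (\<Sum>\<gamma>\<in>\<Psi>. t \<gamma> *\<^sub>R \<gamma>) \<noteq> 0))"
proof -
  have fin: "finite \<Psi>" using assms finite_roots finite_subset by blast
  define vec where "vec t = (\<Sum>\<gamma>\<in>\<Psi>. t \<gamma> *\<^sub>R \<gamma>)" for t :: "real ^ 'n \<Rightarrow> real"
  have vec_add: "vec (\<lambda>\<gamma>. t \<gamma> + c * u \<gamma>) = vec t + c *\<^sub>R vec u" for t u c
    by (simp add: vec_def scaleR_left_distrib sum.distrib scaleR_sum_right)
  have vec_scale: "vec (\<lambda>\<gamma>. c * u \<gamma>) = c *\<^sub>R vec u" for u c
    by (simp add: vec_def scaleR_sum_right)
  have span: "span \<Psi> = range vec" unfolding vec_def by (rule span_finite[OF fin])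
  have bounded: "\<exists>M>0. \<forall>\<beta>\<in>\<Psi>. \<bar>f \<beta>\<bar> \<le> M" for f :: "real ^ 'n \<Rightarrow> real"
  proof (intro exI conjI ballI)
    show "(\<Sum>\<beta>\<in>\<Psi>. \<bar>f \<beta>\<bar>) + 1 > 0" by (simp add: sum_nonneg add_nonneg_pos)
    fix \<beta> assume "\<beta> \<in> \<Psi>"
    then show "\<bar>f \<beta>\<bar> \<le> (\<Sum>\<beta>\<in>\<Psi>. \<bar>f \<beta>\<bar>) + 1"
      using member_le_sum[of \<beta> \<Psi> "\<lambda>\<beta>. \<bar>f \<beta>\<bar>"] fin by simp
  qed
  have "\<Psi> \<subseteq> span \<Psi> - {0}" using assms zero_not_root by (auto intro: span_base)
  from avoid_orthogonal_hyperplanes[OF subspace_span fin this]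
  obtain v0 where v0: "v0 \<in> span \<Psi>" "\<forall>\<beta>\<in>\<Psi>. \<beta> \<bullet> v0 \<noteq> 0" by blast
  then obtain u0 where u0: "\<And>\<beta>. \<beta> \<in> \<Psi> \<Longrightarrow> \<beta> \<bullet> vec u0 \<noteq> 0" unfolding span by blast
  obtain M0 where M0: "M0 > 0" "\<And>\<beta>. \<beta> \<in> \<Psi> \<Longrightarrow> \<bar>u0 \<beta>\<bar> \<le> M0" using bounded[of u0] by blast
  define t0 where "t0 \<gamma> = 1 / (2 * M0) * u0 \<gamma>" for \<gamma>
  have t0: "\<bar>t0 \<beta>\<bar> \<le> 1 / 2" if "\<beta> \<in> \<Psi>" for \<beta>
    using M0(1) M0(2)[OF that] by (simp add: t0_def field_simps abs_mult)
  have "vec t0 = (1 / (2 * M0)) *\<^sub>R vec u0" unfolding t0_def by (rule vec_scale)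
  then have t0_nz: "\<beta> \<bullet> vec t0 \<noteq> 0" if "\<beta> \<in> \<Psi>" for \<beta> using u0[OF that] M0(1) by simp
  obtain M1 where M1: "M1 > 0" "\<And>\<beta>. \<beta> \<in> \<Psi> \<Longrightarrow> \<bar>1 / (\<beta> \<bullet> vec t0)\<bar> \<le> M1"
    using bounded[of "\<lambda>\<beta>. 1 / (\<beta> \<bullet> vec t0)"] by blast
  define \<kappa> where "\<kappa> = 1 / (2 * M1)"
  have \<kappa>: "\<kappa> > 0" using M1(1) by (simp add: \<kappa>_def)
  have t0_far: "2 * \<kappa> \<le> \<bar>\<beta> \<bullet> vec t0\<bar>" if "\<beta> \<in> \<Psi>" for \<beta>
    using M1(1) M1(2)[OF that] t0_nz[OF that] by (simp add: \<kappa>_def field_simps)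
  show ?thesis
  proof (rule exI[of _ \<kappa>], intro conjI allI impI \<kappa>)
    fix S assume S: "finite S \<and> S \<subseteq> span \<Psi> - {0}"
    from avoid_orthogonal_hyperplanes[OF subspace_span conjunct1[OF S] conjunct2[OF S]]
    obtain v1 where v1: "v1 \<in> span \<Psi>" "\<forall>s\<in>S. s \<bullet> v1 \<noteq> 0" by blast
    then obtain t1 where t1: "\<And>s. s \<in> S \<Longrightarrow> s \<bullet> vec t1 \<noteq> 0" unfolding span by blast
    obtain M where M: "M > 0" "\<And>\<beta>. \<beta> \<in> \<Psi> \<Longrightarrow> \<bar>\<bar>t1 \<beta>\<bar> + \<bar>\<beta> \<bullet> vec t1\<bar>\<bar> \<le> M"
      using bounded[of "\<lambda>\<beta>. \<bar>t1 \<beta>\<bar> + \<bar>\<beta> \<bullet> vec t1\<bar>"] by blast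
    define \<delta> where "\<delta> = min (1 / 2) \<kappa> / M"
    have \<delta>: "\<delta> > 0" "\<delta> * M = min (1 / 2) \<kappa>" using \<kappa> M(1) by (auto simp: \<delta>_def)
    define bad where "bad = (\<lambda>s. - (s \<bullet> vec t0) / (s \<bullet> vec t1)) ` S"
    have "infinite ({0<..<\<delta>} - bad)"
      using S \<delta>(1) by (intro Diff_infinite_finite) (auto simp: bad_def infinite_Ioo)
    then obtain \<tau> where \<tau>: "0 < \<tau>" "\<tau> < \<delta>" "\<tau> \<notin> bad"
      using infinite_imp_nonempty by (metis Diff_iff ex_in_conv greaterThanLessThan_iff)
    have small: "\<tau> * \<bar>x\<bar> \<le> min (1 / 2) \<kappa>" if "\<bar>x\<bar> \<le> M" for x
      using mult_mono[of \<tau> \<delta> "\<bar>x\<bar>" M] \<tau> \<delta> that by simp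
    define t where "t \<gamma> = t0 \<gamma> + \<tau> * t1 \<gamma>" for \<gamma>
    have vec_t: "vec t = vec t0 + \<tau> *\<^sub>R vec t1" unfolding t_def by (rule vec_add)
    have "\<bar>t \<beta>\<bar> \<le> 1" if "\<beta> \<in> \<Psi>" for \<beta>
    proof -
      have "\<bar>t1 \<beta>\<bar> \<le> M" using M(2)[OF that] by linarith
      then have "\<bar>\<tau> * t1 \<beta>\<bar> \<le> 1 / 2" using small[of "t1 \<beta>"] \<tau>(1) by (simp add: abs_mult)
      then show ?thesis using t0[OF that] unfolding t_def by linarith
    qed
    moreover have "\<kappa> \<le> \<bar>\<beta> \<bullet> vec t\<bar>" if "\<beta> \<in> \<Psi>" for \<beta>
    proof -
      have "\<bar>\<beta> \<bullet> vec t1\<bar> \<le> M" using M(2)[OF that] by linarith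
      then have "\<bar>\<tau> * (\<beta> \<bullet> vec t1)\<bar> \<le> \<kappa>" using small[of "\<beta> \<bullet> vec t1"] \<tau>(1) by (simp add: abs_mult)
      then show ?thesis using t0_far[OF that] unfolding vec_t inner_add_right inner_scaleR_right by linarith
    qed
    moreover have "s \<bullet> vec t \<noteq> 0" if "s \<in> S" for s
    proof
      assume "s \<bullet> vec t = 0"
      then have "\<tau> = - (s \<bullet> vec t0) / (s \<bullet> vec t1)"
        using t1[OF that] by (simp add: vec_t inner_add_right field_simps)
      then show False using \<tau>(3) that by (auto simp: bad_def)
    qed
    ultimately show "\<exists>t. (\<forall>\<beta>\<in>\<Psi>. \<bar>t \<beta>\<bar> \<le> 1) \<and> (\<forall>\<beta>\<in>\<Psi>. \<kappa> \<le> \<bar>\<beta> \<bullet> (\<Sum>\<gamma>\<in>\<Psi>. t \<gamma> *\<^sub>R \<gamma>)\<bar>) \<and>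
      (\<forall>s\<in>S. s \<bullet> (\<Sum>\<gamma>\<in>\<Psi>. t \<gamma> *\<^sub>R \<gamma>) \<noteq> 0)"
      unfolding vec_def by blast
  qed
qed

lemma positive_roots_independent:
  assumes "\<alpha> \<in> \<Phi> \<inter> P" "\<beta> \<in> \<Phi> \<inter> P" "\<alpha> \<noteq> \<beta>" "x *\<^sub>R \<alpha> = y *\<^sub>R \<beta>"
  shows "x = 0"
proof (rule ccontr)
  assume x: "x \<noteq> 0"
  then have \<alpha>: "\<alpha> = (y / x) *\<^sub>R \<beta>"
    using assms(4) by (metis divideR_right divide_inverse_commute scaleR_scaleR)
  then have "y / x = 1 \<or> y / x = - 1"
    using root_system assms(1,2) unfolding root_system_def by (metis Int_iff)
  then show False using \<alpha> assms(1-3) uminus_positive(1)[of \<beta>] by auto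
qed

text \<open>On the line through \<open>(a, b)\<close> in the direction \<open>v\<close>, the root \<open>\<beta>\<close> vanishes at
  \<open>z = - \<beta>(a + \<i> b) / (\<beta> \<bullet> v)\<close>.  For generic \<open>v\<close> these zeros are distinct for distinct positive roots: a coincidence for
  \<open>\<alpha>\<close> and \<open>\<beta>\<close> is a linear condition on \<open>v\<close>, nontrivial because the two roots are linearly
  independent and do not vanish at \<open>(a, b)\<close>.  They lie in the disc of radius \<open>1 / (\<kappa> * R)\<close>, and the bound
  for entire functions with prescribed zeros applies.  The constant \<open>\<kappa>\<close> depends on \<open>\<Psi>\<close> alone.\<close>

lemma division_by_roots:
  assumes "\<Psi> \<subseteq> \<Phi>"
  shows "\<exists>\<kappa>>0. \<forall>K G a b R B. K \<subseteq> \<Psi> \<longrightarrow> R > 0 \<longrightarrow>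
    (\<forall>\<beta>\<in>K. cpair \<beta> a b \<noteq> 0 \<and> cmod (cpair \<beta> a b) * R \<le> 1) \<longrightarrow>
    (\<forall>v. (\<lambda>z. G (a + Re z *\<^sub>R v) (b + Im z *\<^sub>R v)) holomorphic_on UNIV) \<longrightarrow>
    (\<forall>\<beta>\<in>K. \<forall>a b. cpair \<beta> a b = 0 \<longrightarrow> G a b = 0) \<longrightarrow>
    (\<forall>t z. (\<forall>\<beta>\<in>\<Psi>. \<bar>t \<beta>\<bar> \<le> 1) \<longrightarrow> cmod z \<le> 3 / (\<kappa> * R) \<longrightarrow>
      cmod (G (a + Re z *\<^sub>R (\<Sum>\<gamma>\<in>\<Psi>. t \<gamma> *\<^sub>R \<gamma>)) (b + Im z *\<^sub>R (\<Sum>\<gamma>\<in>\<Psi>. t \<gamma> *\<^sub>R \<gamma>))) \<le> B) \<longrightarrow>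
    cmod (G a b) \<le> (\<Prod>\<beta>\<in>K \<inter> P. cmod (cpair \<beta> a b) * R) * B"
proof -
  obtain \<kappa> where \<kappa>: "\<kappa> > 0" and generic: "\<forall>S. finite S \<and> S \<subseteq> span \<Psi> - {0} \<longrightarrow>
    (\<exists>t. (\<forall>\<beta>\<in>\<Psi>. \<bar>t \<beta>\<bar> \<le> 1) \<and> (\<forall>\<beta>\<in>\<Psi>. \<kappa> \<le> \<bar>\<beta> \<bullet> (\<Sum>\<gamma>\<in>\<Psi>. t \<gamma> *\<^sub>R \<gamma>)\<bar>) \<and>
      (\<forall>s\<in>S. s \<bullet> (\<Sum>\<gamma>\<in>\<Psi>. t \<gamma> *\<^sub>R \<gamma>) \<noteq> 0))"
    using generic_direction[OF assms] by (elim exE conjE)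
  show ?thesis
  proof (rule exI[of _ \<kappa>], intro conjI allI impI \<kappa>)
    fix K :: "(real ^ 'n) set" and G :: "real ^ 'n \<Rightarrow> real ^ 'n \<Rightarrow> complex" and a b and R B :: real
    assume K: "K \<subseteq> \<Psi>" and R: "R > 0"
      and small: "\<forall>\<beta>\<in>K. cpair \<beta> a b \<noteq> 0 \<and> cmod (cpair \<beta> a b) * R \<le> 1"
      and hol: "\<forall>v. (\<lambda>z. G (a + Re z *\<^sub>R v) (b + Im z *\<^sub>R v)) holomorphic_on UNIV"
      and zero: "\<forall>\<beta>\<in>K. \<forall>a b. cpair \<beta> a b = 0 \<longrightarrow> G a b = 0"
      and bound: "\<forall>t z. (\<forall>\<beta>\<in>\<Psi>. \<bar>t \<beta>\<bar> \<le> 1) \<longrightarrow> cmod z \<le> 3 / (\<kappa> * R) \<longrightarrow>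
        cmod (G (a + Re z *\<^sub>R (\<Sum>\<gamma>\<in>\<Psi>. t \<gamma> *\<^sub>R \<gamma>)) (b + Im z *\<^sub>R (\<Sum>\<gamma>\<in>\<Psi>. t \<gamma> *\<^sub>R \<gamma>))) \<le> B"
    have finK: "finite K" by (rule finite_subset[OF subset_trans[OF K assms] finite_roots])
    \<comment> \<open>the vectors to which \<open>v\<close> must not be orthogonal, one for the real and one for the imaginary part\<close>
    define D where "D c \<alpha> \<beta> = (\<alpha> \<bullet> c) *\<^sub>R \<beta> - (\<beta> \<bullet> c) *\<^sub>R \<alpha>" for c \<alpha> \<beta> :: "real ^ 'n"
    define S where "S = ((\<lambda>(\<alpha>, \<beta>). D a \<alpha> \<beta>) ` (K \<times> K) \<union> (\<lambda>(\<alpha>, \<beta>). D b \<alpha> \<beta>) ` (K \<times> K)) - {0}"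
    have "D c \<alpha> \<beta> \<in> span \<Psi>" if "\<alpha> \<in> K" "\<beta> \<in> K" for c \<alpha> \<beta>
      unfolding D_def using K that by (intro span_diff span_scale span_base) auto
    then have "finite S \<and> S \<subseteq> span \<Psi> - {0}" using finK by (auto simp: S_def)
    from generic[rule_format, OF this] obtain t where t: "\<forall>\<beta>\<in>\<Psi>. \<bar>t \<beta>\<bar> \<le> 1"
        "\<forall>\<beta>\<in>\<Psi>. \<kappa> \<le> \<bar>\<beta> \<bullet> (\<Sum>\<gamma>\<in>\<Psi>. t \<gamma> *\<^sub>R \<gamma>)\<bar>"
        "\<forall>s\<in>S. s \<bullet> (\<Sum>\<gamma>\<in>\<Psi>. t \<gamma> *\<^sub>R \<gamma>) \<noteq> 0"
      by (elim exE conjE)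
    define v where "v = (\<Sum>\<gamma>\<in>\<Psi>. t \<gamma> *\<^sub>R \<gamma>)"
    define g where "g z = G (a + Re z *\<^sub>R v) (b + Im z *\<^sub>R v)" for z
    define \<zeta> where "\<zeta> \<beta> = - cpair \<beta> a b / of_real (\<beta> \<bullet> v)" for \<beta>
    define r where "r = 1 / (\<kappa> * R)"
    have r: "r > 0" using \<kappa> R by (simp add: r_def)
    have far: "\<kappa> \<le> \<bar>\<beta> \<bullet> v\<bar>" "\<beta> \<bullet> v \<noteq> 0" if "\<beta> \<in> K" for \<beta>
      using t(2)[rule_format, of \<beta>] that K \<kappa> by (auto simp: v_def)
    have \<zeta>_bound: "cmod (\<zeta> \<beta>) \<le> cmod (cpair \<beta> a b) / \<kappa>" if "\<beta> \<in> K" for \<beta>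
      using far[OF that] \<kappa> by (simp add: \<zeta>_def norm_divide frac_le)
    have "cmod (g 0) \<le> (\<Prod>\<beta>\<in>K \<inter> P. cmod (\<zeta> \<beta>) / (2 * r)) * B"
    proof (rule entire_bound_from_zeros[OF _ _ r])
      show "finite (K \<inter> P)" using finK by simp
      show "g holomorphic_on UNIV" unfolding g_def by (rule hol[rule_format])
      show "inj_on \<zeta> (K \<inter> P)"
      proof (rule inj_onI, rule ccontr)
        fix \<alpha> \<beta> assume *: "\<alpha> \<in> K \<inter> P" "\<beta> \<in> K \<inter> P" "\<zeta> \<alpha> = \<zeta> \<beta>" "\<alpha> \<noteq> \<beta>"
        have "\<alpha> \<bullet> v \<noteq> 0" "\<beta> \<bullet> v \<noteq> 0" using *(1,2) far(2) by auto
        with *(3) have "cpair \<alpha> a b * of_real (\<beta> \<bullet> v) = cpair \<beta> a b * of_real (\<alpha> \<bullet> v)"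
          unfolding \<zeta>_def by (subst (asm) frac_eq_eq) auto
        then have "D a \<alpha> \<beta> \<bullet> v = 0" "D b \<alpha> \<beta> \<bullet> v = 0"
          by (simp_all add: cpair_def complex_eq_iff D_def inner_diff_left)
        moreover have "D a \<alpha> \<beta> \<in> S \<or> D a \<alpha> \<beta> = 0" "D b \<alpha> \<beta> \<in> S \<or> D b \<alpha> \<beta> = 0"
          using * by (auto simp: S_def)
        ultimately have "D a \<alpha> \<beta> = 0" "D b \<alpha> \<beta> = 0" using t(3) by (auto simp: v_def)
        then have "(\<beta> \<bullet> a) *\<^sub>R \<alpha> = (\<alpha> \<bullet> a) *\<^sub>R \<beta>" "(\<beta> \<bullet> b) *\<^sub>R \<alpha> = (\<alpha> \<bullet> b) *\<^sub>R \<beta>"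
          by (simp_all add: D_def)
        moreover have "\<alpha> \<in> \<Phi> \<inter> P" "\<beta> \<in> \<Phi> \<inter> P" using *(1,2) K assms by auto
        ultimately have "\<beta> \<bullet> a = 0" "\<beta> \<bullet> b = 0"
          using positive_roots_independent *(4) by metis+
        then show False using small *(2) by (auto simp: cpair_eq_0_iff)
      qed
      show "g (\<zeta> \<beta>) = 0" if "\<beta> \<in> K \<inter> P" for \<beta>
      proof -
        have "cpair \<beta> (a + Re (\<zeta> \<beta>) *\<^sub>R v) (b + Im (\<zeta> \<beta>) *\<^sub>R v) = 0"
          using far(2)[of \<beta>] that by (subst cpair_line) (simp add: \<zeta>_def)
        then show ?thesis using zero that by (auto simp: g_def)
      qed
      show "cmod (\<zeta> \<beta>) \<le> r" if "\<beta> \<in> K \<inter> P" for \<beta>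
      proof -
        have "cmod (cpair \<beta> a b) / \<kappa> \<le> r"
          using small that \<kappa> R by (auto simp: r_def field_simps)
        then show ?thesis using \<zeta>_bound[of \<beta>] that by simp
      qed
      show "cmod (g z) \<le> B" if "cmod z \<le> 3 * r" for z
        using bound t(1) that by (simp add: g_def v_def r_def)
    qed
    also have "\<dots> \<le> (\<Prod>\<beta>\<in>K \<inter> P. cmod (cpair \<beta> a b) * R) * B"
    proof (rule mult_right_mono)
      have "cmod (G a b) \<le> B"
        using bound[rule_format, of "\<lambda>_. 0" 0] \<kappa> R by simp
      then show "0 \<le> B" using norm_ge_zero order_trans by blast
      show "(\<Prod>\<beta>\<in>K \<inter> P. cmod (\<zeta> \<beta>) / (2 * r)) \<le> (\<Prod>\<beta>\<in>K \<inter> P. cmod (cpair \<beta> a b) * R)"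
      proof (rule prod_mono, rule conjI)
        fix \<beta> assume "\<beta> \<in> K \<inter> P"
        then have "cmod (\<zeta> \<beta>) / (2 * r) \<le> (cmod (cpair \<beta> a b) / \<kappa>) / (2 * r)"
          using \<zeta>_bound[of \<beta>] r by (intro divide_right_mono) auto
        also have "\<dots> \<le> cmod (cpair \<beta> a b) * R" using \<kappa> R by (simp add: r_def)
        finally show "cmod (\<zeta> \<beta>) / (2 * r) \<le> cmod (cpair \<beta> a b) * R" .
      qed (use r in simp)
    qed
    finally show "cmod (G a b) \<le> (\<Prod>\<beta>\<in>K \<inter> P. cmod (cpair \<beta> a b) * R) * B" by (simp add: g_def)
  qed
qed

end

section \<open>The Euclidean estimate\<close>

text \<open>Here \<open>x\<close> and \<open>y\<close> stand for \<open>\<bar>\<alpha>(X)\<bar>\<close> and \<open>\<bar>\<alpha>(w \<lambda>)\<bar>\<close>, \<open>k\<close> says that \<open>w\<close> carries \<open>K\<close> to a set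
  containing \<open>\<alpha>\<close>, and \<open>j\<close> says that \<open>\<alpha>\<close> lies in \<open>J\<close>; \<open>D / R\<close> is the effect of a shift of the spectral
  parameter.  When \<open>k\<close> holds, \<open>x * y \<le> 1\<close>, and the Schwarz factor \<open>R * y\<close> supplies the decay in \<open>y\<close> that
  the shifted factor has lost.  When \<open>k\<close> fails, the shift is at most a multiple of \<open>y\<close>.\<close>

lemma factor_comparison:
  fixes x y R D \<eta> :: real
  assumes "0 < \<eta>" "\<eta> \<le> 1" "0 \<le> D" "0 < R" "0 \<le> x" "x \<le> R" "0 \<le> y"
    and inK: "k \<Longrightarrow> R * y \<le> 1" and outK: "\<not> k \<Longrightarrow> \<eta> \<le> R * y" and outJ: "\<not> j \<Longrightarrow> \<eta> * R \<le> x"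
  shows "(if k then R * y else 1) * (if j then min 1 (x * (y + D / R)) else 1)
    \<le> (1 + D / \<eta>\<^sup>2 + 1 / \<eta>\<^sup>2) * min 1 (x * y)"
proof -
  define c where "c = 1 + D / \<eta>\<^sup>2 + 1 / \<eta>\<^sup>2"
  have \<eta>2: "\<eta>\<^sup>2 \<le> \<eta>" "0 < \<eta>\<^sup>2" using assms(1,2) by (auto simp: power2_eq_square mult_left_le)
  have Dc: "D / \<eta> \<le> D / \<eta>\<^sup>2" "D \<le> D / \<eta>"
    using frac_le[OF assms(3) order_refl \<eta>2(2,1)] frac_le[OF assms(3) order_refl assms(1,2)] by simp_all
  have \<eta>c: "1 / \<eta> \<le> 1 / \<eta>\<^sup>2" using \<eta>2 assms(1) by (simp add: frac_le)
  have pos: "0 \<le> D / \<eta>\<^sup>2" "0 \<le> 1 / \<eta>\<^sup>2" using assms(3) by auto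
  have c: "1 + D \<le> c" "1 + D / \<eta> \<le> c" "1 / \<eta> \<le> c" "1 / \<eta>\<^sup>2 \<le> c" "1 \<le> c"
    using Dc \<eta>c pos unfolding c_def by linarith+
  have xy: "0 \<le> x * y" using assms by simp
  have scale: "min 1 (d * (x * y)) \<le> c * min 1 (x * y)" if "1 \<le> d" "d \<le> c" for d
  proof (cases "x * y \<le> 1")
    case True
    have "d * (x * y) \<le> c * (x * y)" using that xy by (intro mult_right_mono) auto
    then show ?thesis using True by simp
  qed (use that c in auto)
  show ?thesis unfolding c_def[symmetric]
  proof (cases k; cases j)
    assume k and j
    have Ry: "R * y \<le> 1" using inK \<open>k\<close> .
    have small: "x * y \<le> 1" using mult_right_mono[of x R y] assms Ry by linarith
    have "R * y * min 1 (x * (y + D / R)) \<le> R * y * (x * (y + D / R))"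
      using assms by (intro mult_left_mono) auto
    also have "\<dots> = x * y * (R * y + D)" using assms(4) by (simp add: field_simps)
    also have "\<dots> \<le> x * y * c" using xy Ry c(1) by (intro mult_left_mono) auto
    finally show "(if k then R * y else 1) * (if j then min 1 (x * (y + D / R)) else 1) \<le> c * min 1 (x * y)"
      using \<open>k\<close> \<open>j\<close> small by (simp add: mult.commute)
  next
    assume k and "\<not> j"
    have Ry: "R * y \<le> 1" using inK \<open>k\<close> .
    have small: "x * y \<le> 1" using mult_right_mono[of x R y] assms Ry by linarith
    have "\<eta> * R * y \<le> x * y" using outJ[OF \<open>\<not> j\<close>] assms by (intro mult_right_mono) auto
    then have "R * y \<le> 1 / \<eta> * (x * y)" using assms(1) by (simp add: field_simps)
    also have "\<dots> \<le> c * (x * y)" using c(3) xy by (intro mult_right_mono)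
    finally show "(if k then R * y else 1) * (if j then min 1 (x * (y + D / R)) else 1) \<le> c * min 1 (x * y)"
      using \<open>k\<close> \<open>\<not> j\<close> small by simp
  next
    assume "\<not> k" and j
    have "\<eta> \<le> R * y" using outK \<open>\<not> k\<close> .
    then have "D * \<eta> \<le> D * (R * y)" using assms(3) by (intro mult_left_mono)
    then have "D / R \<le> D / \<eta> * y" using assms(1,4) by (simp add: field_simps)
    then have "x * (y + D / R) \<le> x * (y + D / \<eta> * y)" using assms(5) by (intro mult_left_mono) auto
    also have "\<dots> = (1 + D / \<eta>) * (x * y)" by (simp add: algebra_simps)
    finally have "min 1 (x * (y + D / R)) \<le> min 1 ((1 + D / \<eta>) * (x * y))" by simp
    also have "\<dots> \<le> c * min 1 (x * y)" using c assms by (intro scale) auto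
    finally show "(if k then R * y else 1) * (if j then min 1 (x * (y + D / R)) else 1) \<le> c * min 1 (x * y)"
      using \<open>\<not> k\<close> \<open>j\<close> by simp
  next
    assume "\<not> k" "\<not> j"
    have "\<eta> * \<eta> \<le> \<eta> * (R * y)" using outK \<open>\<not> k\<close> assms(1) by (intro mult_left_mono) auto
    also have "\<dots> = (\<eta> * R) * y" by simp
    also have "\<dots> \<le> x * y" using outJ \<open>\<not> j\<close> assms(7) by (intro mult_right_mono) auto
    finally have *: "\<eta>\<^sup>2 \<le> x * y" by (simp add: power2_eq_square)
    have "1 \<le> c * min 1 (x * y)"
    proof (cases "x * y \<le> 1")
      case True
      have "1 = 1 / \<eta>\<^sup>2 * \<eta>\<^sup>2" using \<eta>2 by simp
      also have "\<dots> \<le> c * (x * y)" using * c \<eta>2 by (intro mult_mono) auto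
      finally show ?thesis using True by simp
    qed (use c in auto)
    then show "(if k then R * y else 1) * (if j then min 1 (x * (y + D / R)) else 1) \<le> c * min 1 (x * y)"
      using \<open>\<not> k\<close> \<open>\<not> j\<close> by simp
  qed
qed

context positive_root_system
begin

definition majorant where
  "majorant \<Psi> a b X w = (\<Prod>\<alpha>\<in>\<Psi> \<inter> P. min 1 (\<bar>\<alpha> \<bullet> X\<bar> * cmod (cpair \<alpha> (w a) (w b))))"

text \<open>The condition on \<open>b\<close> keeps all exponentials of the alternant bounded.  It is imposed on the orbit
  of \<open>b\<close> and not through norms, because \<open>X\<close> may be large in the directions orthogonal to
  \<open>\<Psi>\<close>.\<close>

definition euclidean_bound where
  "euclidean_bound \<Psi> c C \<longleftrightarrow>
    (\<forall>a b X. (\<forall>w\<in>weyl_group \<Psi>. \<bar>w b \<bullet> X\<bar> \<le> c) \<longrightarrow>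
      cmod (alternant \<Psi> a b X) \<le> C * (\<Sum>w\<in>weyl_group \<Psi>. majorant \<Psi> a b X w))"

lemma majorant_nonneg: "majorant \<Psi> a b X w \<ge> 0"
  by (simp add: majorant_def prod_nonneg)

lemma euclidean_bound_mono: "euclidean_bound \<Psi> c C \<Longrightarrow> C \<le> D \<Longrightarrow> euclidean_bound \<Psi> c D"
  unfolding euclidean_bound_def
  by (meson majorant_nonneg mult_right_mono order_trans sum_nonneg)

lemma coroot_bound: "\<exists>N\<ge>1. \<forall>\<alpha>\<in>\<Phi>. \<forall>\<beta>\<in>\<Phi>. \<bar>\<beta> \<bullet> coroot \<alpha>\<bar> \<le> N \<and> \<bar>\<alpha> \<bullet> \<beta>\<bar> \<le> N"
proof -
  have "\<exists>N\<ge>0. \<forall>p\<in>\<Phi> \<times> \<Phi>. \<bar>snd p \<bullet> coroot (fst p)\<bar> \<le> N \<and> \<bar>fst p \<bullet> snd p\<bar> \<le> N"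
  proof (rule uniform_constant)
    show "\<exists>N. \<bar>snd p \<bullet> coroot (fst p)\<bar> \<le> N \<and> \<bar>fst p \<bullet> snd p\<bar> \<le> N" for p :: "(real ^ 'n) \<times> (real ^ 'n)"
      by (meson max.cobounded1 max.cobounded2)
  qed (use finite_roots in auto)
  then obtain N where "\<forall>\<alpha>\<in>\<Phi>. \<forall>\<beta>\<in>\<Phi>. \<bar>\<beta> \<bullet> coroot \<alpha>\<bar> \<le> N \<and> \<bar>\<alpha> \<bullet> \<beta>\<bar> \<le> N" by auto
  then have "\<forall>\<alpha>\<in>\<Phi>. \<forall>\<beta>\<in>\<Phi>. \<bar>\<beta> \<bullet> coroot \<alpha>\<bar> \<le> max 1 N \<and> \<bar>\<alpha> \<bullet> \<beta>\<bar> \<le> max 1 N"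
    by (meson le_max_iff_disj)
  then show ?thesis by (metis max.cobounded1)
qed

text \<open>A reflection \<open>reflection \<alpha> \<beta>\<close> with \<open>f \<alpha>, f \<beta> \<le> \<theta>\<close> has value at most \<open>(1 + N) * \<theta>\<close>, and the gap above \<open>\<theta>\<close> brings
  it back below \<open>\<theta>\<close>.\<close>

lemma subadditive_sublevel_closed:
  assumes "\<Psi> \<subseteq> \<Phi>" "reflection_closed \<Psi>"
    and "\<And>\<alpha> \<beta>. \<alpha> \<in> \<Psi> \<Longrightarrow> \<beta> \<in> \<Psi> \<Longrightarrow> f (reflection \<alpha> \<beta>) \<le> f \<beta> + N * f \<alpha>"
    and "0 \<le> N" "\<And>\<alpha>. \<alpha> \<in> \<Psi> \<Longrightarrow> f \<alpha> \<le> (1 + N) * \<theta> \<Longrightarrow> f \<alpha> \<le> \<theta>"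
  shows "reflection_closed {\<alpha> \<in> \<Psi>. f \<alpha> \<le> (\<theta>::real)}"
  unfolding reflection_closed_def
proof (intro conjI ballI)
  show "0 \<notin> {\<alpha> \<in> \<Psi>. f \<alpha> \<le> \<theta>}" using assms(2) by (auto simp: reflection_closed_def)
  fix \<alpha> \<beta> assume *: "\<alpha> \<in> {\<alpha> \<in> \<Psi>. f \<alpha> \<le> \<theta>}" "\<beta> \<in> {\<alpha> \<in> \<Psi>. f \<alpha> \<le> \<theta>}"
  then have "f (reflection \<alpha> \<beta>) \<le> \<theta> + N * \<theta>"
    using assms(3)[of \<alpha> \<beta>] mult_left_mono[of "f \<alpha>" \<theta> N] assms(4) by auto
  moreover have "reflection \<alpha> \<beta> \<in> \<Psi>" using * assms(2) by (auto simp: reflection_closed_def)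
  ultimately show "reflection \<alpha> \<beta> \<in> {\<alpha> \<in> \<Psi>. f \<alpha> \<le> \<theta>}"
    using assms(5) by (simp add: distrib_right)
qed

lemma spatial_subadditive:
  assumes "\<bar>\<beta> \<bullet> coroot \<alpha>\<bar> \<le> N"
  shows "\<bar>reflection \<alpha> \<beta> \<bullet> X\<bar> \<le> \<bar>\<beta> \<bullet> X\<bar> + N * \<bar>\<alpha> \<bullet> X\<bar>"
proof -
  have "\<bar>reflection \<alpha> \<beta> \<bullet> X\<bar> \<le> \<bar>\<beta> \<bullet> X\<bar> + \<bar>\<beta> \<bullet> coroot \<alpha>\<bar> * \<bar>\<alpha> \<bullet> X\<bar>"
    unfolding reflection_def inner_diff_left inner_scaleR_left
    using abs_triangle_ineq4 by (metis abs_mult)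
  also have "\<dots> \<le> \<bar>\<beta> \<bullet> X\<bar> + N * \<bar>\<alpha> \<bullet> X\<bar>" using assms by (simp add: mult_right_mono)
  finally show ?thesis .
qed

lemma spectral_subadditive:
  assumes "\<bar>\<beta> \<bullet> coroot \<alpha>\<bar> \<le> N"
  shows "cmod (cpair (reflection \<alpha> \<beta>) a b) \<le> cmod (cpair \<beta> a b) + N * cmod (cpair \<alpha> a b)"
proof -
  have "cpair (reflection \<alpha> \<beta>) a b = cpair \<beta> a b - of_real (\<beta> \<bullet> coroot \<alpha>) * cpair \<alpha> a b"
    by (simp add: reflection_def cpair_def complex_eq_iff inner_diff_left)
  then have "cmod (cpair (reflection \<alpha> \<beta>) a b) \<le> cmod (cpair \<beta> a b) + \<bar>\<beta> \<bullet> coroot \<alpha>\<bar> * cmod (cpair \<alpha> a b)"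
    by (metis norm_mult norm_of_real norm_triangle_ineq4)
  also have "\<dots> \<le> cmod (cpair \<beta> a b) + N * cmod (cpair \<alpha> a b)" using assms by (simp add: mult_right_mono)
  finally show ?thesis .
qed

lemma weyl_adjoint:
  assumes "w \<in> weyl_group \<Psi>"
  shows "\<exists>u\<in>weyl_group \<Psi>. u \<circ> w = id \<and> w \<circ> u = id \<and> (\<forall>x y. x \<bullet> w y = u x \<bullet> y)"
proof -
  obtain u where u: "u \<in> weyl_group \<Psi>" "u \<circ> w = id" "w \<circ> u = id"
    using weyl_inverse[OF assms] by blast
  have "x \<bullet> w y = u x \<bullet> y" for x y
  proof -
    have "w (u x) \<bullet> w y = u x \<bullet> y"
      using weyl_orthogonal[OF assms] by (simp add: orthogonal_transformation_def)
    then show ?thesis using u(3) by (metis comp_apply id_apply)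
  qed
  then show ?thesis using u by blast
qed

text \<open>The product over \<open>K\<close> is transported by \<open>u\<close> to a product over \<open>u ` K\<close>, after which both sides are
  products over the positive roots of \<open>\<Psi>\<close> and can be compared factor by factor.\<close>

lemma comparison_product:
  assumes "\<Psi> \<subseteq> \<Phi>" and u: "u \<in> weyl_group \<Psi>" and closed: "reflection_closed \<Psi>"
    and "J = {\<alpha> \<in> \<Psi>. \<bar>\<alpha> \<bullet> X\<bar> \<le> \<theta>J * R}" and K: "K = {\<beta> \<in> \<Psi>. cmod (cpair \<beta> a b) * R \<le> \<theta>K}"
    and closedK: "reflection_closed K"
    and \<eta>: "0 < \<eta>" "\<eta> \<le> \<theta>J" "\<eta> \<le> \<theta>K" "\<theta>K \<le> 1" and "D \<ge> 0" "R > 0"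
    and R: "\<And>\<alpha>. \<alpha> \<in> \<Psi> \<Longrightarrow> \<bar>\<alpha> \<bullet> X\<bar> \<le> R"
  shows "(\<Prod>\<beta>\<in>K \<inter> P. cmod (cpair \<beta> a b) * R) *
      (\<Prod>\<alpha>\<in>J \<inter> P. min 1 (\<bar>\<alpha> \<bullet> X\<bar> * (cmod (cpair \<alpha> (u a) (u b)) + D / R)))
    \<le> (1 + D / \<eta>\<^sup>2 + 1 / \<eta>\<^sup>2) ^ card (\<Psi> \<inter> P) * majorant \<Psi> a b X u"
proof -
  have fin: "finite \<Psi>" by (rule finite_subset[OF assms(1) finite_roots])
  define y where "y \<alpha> = cmod (cpair \<alpha> (u a) (u b))" for \<alpha>
  have u\<Phi>: "u \<in> weyl_group \<Phi>" using u weyl_mono[OF assms(1)] by blast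
  have y: "y (u \<beta>) = cmod (cpair \<beta> a b)" for \<beta>
    using cpair_orthogonal[OF weyl_orthogonal[OF u]] by (simp add: y_def)
  have JK: "J \<subseteq> \<Psi>" "K \<subseteq> \<Psi>" "u ` K \<subseteq> \<Psi>"
    using assms(4) K weyl_maps_roots[OF closed u] by auto
  have ysmall: "R * y \<alpha> \<le> \<theta>K \<longleftrightarrow> \<alpha> \<in> u ` K" if \<alpha>: "\<alpha> \<in> \<Psi>" for \<alpha>
  proof -
    obtain v where v: "v \<in> weyl_group \<Psi>" "u \<circ> v = id" "v \<circ> u = id"
      using weyl_inverse[OF u] by blast
    have v\<alpha>: "v \<alpha> \<in> \<Psi>" "u (v \<alpha>) = \<alpha>"
      using weyl_maps_roots[OF closed v(1) \<alpha>] v(2) by (auto simp: fun_eq_iff)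
    have "\<alpha> \<in> u ` K \<longleftrightarrow> v \<alpha> \<in> K" using v\<alpha>(2) v(3) by (auto simp: fun_eq_iff image_iff) metis
    also have "\<dots> \<longleftrightarrow> R * y \<alpha> \<le> \<theta>K" using y[of "v \<alpha>"] v\<alpha> by (simp add: K mult.commute)
    finally show ?thesis by blast
  qed
  have "(\<Prod>\<beta>\<in>K \<inter> P. cmod (cpair \<beta> a b) * R) = (\<Prod>\<alpha>\<in>u ` K \<inter> P. R * y \<alpha>)"
    using assms(1) JK(2) \<open>R > 0\<close>
    by (intro prod_positive_weyl_image[OF _ closedK u\<Phi>]) (auto simp: y cpair_uminus mult.commute)
  also have "\<dots> = (\<Prod>\<alpha>\<in>\<Psi> \<inter> P. if \<alpha> \<in> u ` K then R * y \<alpha> else 1)"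
    by (rule prod.mono_neutral_cong_left) (use fin JK(3) in auto)
  finally have 1: "(\<Prod>\<beta>\<in>K \<inter> P. cmod (cpair \<beta> a b) * R) = (\<Prod>\<alpha>\<in>\<Psi> \<inter> P. if \<alpha> \<in> u ` K then R * y \<alpha> else 1)" .
  have 2: "(\<Prod>\<alpha>\<in>J \<inter> P. min 1 (\<bar>\<alpha> \<bullet> X\<bar> * (y \<alpha> + D / R)))
      = (\<Prod>\<alpha>\<in>\<Psi> \<inter> P. if \<alpha> \<in> J then min 1 (\<bar>\<alpha> \<bullet> X\<bar> * (y \<alpha> + D / R)) else 1)"
    by (rule prod.mono_neutral_cong_left) (use fin JK(1) in auto)
  have "(\<Prod>\<beta>\<in>K \<inter> P. cmod (cpair \<beta> a b) * R) * (\<Prod>\<alpha>\<in>J \<inter> P. min 1 (\<bar>\<alpha> \<bullet> X\<bar> * (y \<alpha> + D / R)))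
      = (\<Prod>\<alpha>\<in>\<Psi> \<inter> P. (if \<alpha> \<in> u ` K then R * y \<alpha> else 1) *
          (if \<alpha> \<in> J then min 1 (\<bar>\<alpha> \<bullet> X\<bar> * (y \<alpha> + D / R)) else 1))"
    unfolding 1 2 by (simp add: prod.distrib)
  also have "\<dots> \<le> (\<Prod>\<alpha>\<in>\<Psi> \<inter> P. (1 + D / \<eta>\<^sup>2 + 1 / \<eta>\<^sup>2) * min 1 (\<bar>\<alpha> \<bullet> X\<bar> * y \<alpha>))"
  proof (rule prod_mono, rule conjI)
    fix \<alpha> assume "\<alpha> \<in> \<Psi> \<inter> P"
    then have \<alpha>: "\<alpha> \<in> \<Psi>" by blast
    have "0 \<le> y \<alpha>" by (simp add: y_def)
    then show "0 \<le> (if \<alpha> \<in> u ` K then R * y \<alpha> else 1) *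
          (if \<alpha> \<in> J then min 1 (\<bar>\<alpha> \<bullet> X\<bar> * (y \<alpha> + D / R)) else 1)"
      using \<open>R > 0\<close> \<open>D \<ge> 0\<close> by simp
    show "(if \<alpha> \<in> u ` K then R * y \<alpha> else 1) *
          (if \<alpha> \<in> J then min 1 (\<bar>\<alpha> \<bullet> X\<bar> * (y \<alpha> + D / R)) else 1)
        \<le> (1 + D / \<eta>\<^sup>2 + 1 / \<eta>\<^sup>2) * min 1 (\<bar>\<alpha> \<bullet> X\<bar> * y \<alpha>)"
    proof (rule factor_comparison)
      show "\<alpha> \<in> u ` K \<Longrightarrow> R * y \<alpha> \<le> 1" "\<alpha> \<notin> u ` K \<Longrightarrow> \<eta> \<le> R * y \<alpha>"
        using ysmall[OF \<alpha>] \<eta> by linarith+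
      show "\<eta> * R \<le> \<bar>\<alpha> \<bullet> X\<bar>" if "\<alpha> \<notin> J"
      proof -
        have "\<eta> * R \<le> \<theta>J * R" using \<eta>(2) \<open>R > 0\<close> by simp
        moreover have "\<theta>J * R < \<bar>\<alpha> \<bullet> X\<bar>" using that assms(4) \<alpha> by simp
        ultimately show ?thesis by linarith
      qed
    qed (use \<eta> \<open>D \<ge> 0\<close> \<open>R > 0\<close> R[OF \<alpha>] \<open>0 \<le> y \<alpha>\<close> in auto)
  qed
  also have "\<dots> = (1 + D / \<eta>\<^sup>2 + 1 / \<eta>\<^sup>2) ^ card (\<Psi> \<inter> P) * majorant \<Psi> a b X u"
    by (simp add: prod.distrib majorant_def y_def)
  finally show ?thesis unfolding y_def .
qed

lemma majorant_empty: "majorant {} a b X w = 1"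
  by (simp add: majorant_def)

lemma euclidean_bound_empty: "\<exists>C. euclidean_bound {} c C"
proof (intro exI[of _ "exp c"])
  show "euclidean_bound {} c (exp c)"
    unfolding euclidean_bound_def alternant_def weyl_group_empty majorant_empty
    by (auto simp: cpair_def norm_mult matrix_id_mat_1 det_I inner_commute)
qed

lemma euclidean_bound_step:
  assumes sub: "\<Psi> \<subseteq> \<Phi>" and closed: "reflection_closed \<Psi>" and nonempty: "\<Psi> \<noteq> {}"
    and IH: "\<And>J c. J \<subset> \<Psi> \<Longrightarrow> reflection_closed J \<Longrightarrow> \<exists>C. euclidean_bound J c C"
  shows "\<exists>C. euclidean_bound \<Psi> c C"
proof -
  have fin: "finite \<Psi>" by (rule finite_subset[OF sub finite_roots])
  have finW: "finite (weyl_group \<Psi>)" by (rule finite_weyl[OF sub])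
  define n where "n = real (card \<Psi>)"
  obtain N where N: "N \<ge> 1" "\<And>\<alpha> \<beta>. \<alpha> \<in> \<Phi> \<Longrightarrow> \<beta> \<in> \<Phi> \<Longrightarrow> \<bar>\<beta> \<bullet> coroot \<alpha>\<bar> \<le> N \<and> \<bar>\<alpha> \<bullet> \<beta>\<bar> \<le> N"
    using coroot_bound by blast
  define \<eta> where "\<eta> = 1 / (1 + N) ^ (card \<Psi> + 1)"
  have \<eta>: "0 < \<eta>" using N(1) by (simp add: \<eta>_def)
  have gap: "\<exists>\<theta>. \<eta> \<le> \<theta> \<and> \<theta> < 1 \<and> (\<forall>\<alpha>\<in>\<Psi>. f \<alpha> \<le> (1 + N) * \<theta> \<longrightarrow> f \<alpha> \<le> \<theta>)" for f
  proof -
    have "1 / (1 + N) < 1" using N(1) by simp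
    then show ?thesis using threshold_gap[OF fin order_refl, of "1 + N" f] N(1)
      unfolding \<eta>_def by (metis add_less_cancel_right add_0 le_less_trans less_le_trans less_add_same_cancel1 zero_less_one)
  qed
  obtain \<kappa> where \<kappa>: "\<kappa> > 0" and division: "\<forall>K G a b R B. K \<subseteq> \<Psi> \<longrightarrow> R > 0 \<longrightarrow>
    (\<forall>\<beta>\<in>K. cpair \<beta> a b \<noteq> 0 \<and> cmod (cpair \<beta> a b) * R \<le> 1) \<longrightarrow>
    (\<forall>v. (\<lambda>z. G (a + Re z *\<^sub>R v) (b + Im z *\<^sub>R v)) holomorphic_on UNIV) \<longrightarrow>
    (\<forall>\<beta>\<in>K. \<forall>a b. cpair \<beta> a b = 0 \<longrightarrow> G a b = 0) \<longrightarrow>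
    (\<forall>t z. (\<forall>\<beta>\<in>\<Psi>. \<bar>t \<beta>\<bar> \<le> 1) \<longrightarrow> cmod z \<le> 3 / (\<kappa> * R) \<longrightarrow>
      cmod (G (a + Re z *\<^sub>R (\<Sum>\<gamma>\<in>\<Psi>. t \<gamma> *\<^sub>R \<gamma>)) (b + Im z *\<^sub>R (\<Sum>\<gamma>\<in>\<Psi>. t \<gamma> *\<^sub>R \<gamma>))) \<le> B) \<longrightarrow>
    cmod (G a b) \<le> (\<Prod>\<beta>\<in>K \<inter> P. cmod (cpair \<beta> a b) * R) * B"
    using division_by_roots[OF sub] by (elim exE conjE)
  \<comment> \<open>shifts have size at most \<open>3 / (\<kappa> * R)\<close>, and roots pair with the shift direction to at most \<open>n * N\<close>,
    its orbit with \<open>X\<close> to at most \<open>n * R\<close>\<close>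
  define c' where "c' = c + 3 * n / \<kappa>"
  define D where "D = 3 * n * N / \<kappa>"
  have D: "D \<ge> 0" using \<kappa> N(1) by (simp add: D_def n_def)
  have "\<exists>C\<ge>0. \<forall>J\<in>{J. J \<subset> \<Psi> \<and> reflection_closed J}. euclidean_bound J c' C"
  proof (rule uniform_constant)
    show "finite {J. J \<subset> \<Psi> \<and> reflection_closed J}"
      by (rule finite_subset[OF _ finite_Pow_iff[THEN iffD2, OF fin]]) auto
  qed (use IH euclidean_bound_mono in auto)
  then obtain C1 where C1: "C1 \<ge> 0" "\<And>J. J \<subset> \<Psi> \<Longrightarrow> reflection_closed J \<Longrightarrow> euclidean_bound J c' C1"
    by blast
  define C2 where "C2 = (1 + D / \<eta>\<^sup>2 + 1 / \<eta>\<^sup>2) ^ card (\<Psi> \<inter> P)"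
  have C2: "C2 \<ge> 0" using D by (simp add: C2_def)
  have "euclidean_bound \<Psi> c (C1 * C2)"
    unfolding euclidean_bound_def
  proof (intro allI impI)
    fix a b X assume imag: "\<forall>w\<in>weyl_group \<Psi>. \<bar>w b \<bullet> X\<bar> \<le> c"
    have rhs: "0 \<le> C1 * C2 * (\<Sum>w\<in>weyl_group \<Psi>. majorant \<Psi> a b X w)"
      using C1(1) C2 majorant_nonneg by (intro mult_nonneg_nonneg sum_nonneg)
    define R where "R = Max ((\<lambda>\<alpha>. \<bar>\<alpha> \<bullet> X\<bar>) ` \<Psi>)"
    have R_ge: "\<bar>\<alpha> \<bullet> X\<bar> \<le> R" if "\<alpha> \<in> \<Psi>" for \<alpha> using fin that by (simp add: R_def)
    have "R \<in> (\<lambda>\<alpha>. \<bar>\<alpha> \<bullet> X\<bar>) ` \<Psi>" unfolding R_def using fin nonempty by (intro Max_in) auto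
    then obtain \<alpha>0 where \<alpha>0: "\<alpha>0 \<in> \<Psi>" "\<bar>\<alpha>0 \<bullet> X\<bar> = R" by auto
    have nz: "\<alpha> \<noteq> 0" if "\<alpha> \<in> \<Psi>" for \<alpha> using that closed by (auto simp: reflection_closed_def)
    \<comment> \<open>if all roots vanish at \<open>X\<close>, or some root vanishes at \<open>a + \<i> b\<close>, then antisymmetry makes the alternant zero\<close>
    show "cmod (alternant \<Psi> a b X) \<le> C1 * C2 * (\<Sum>w\<in>weyl_group \<Psi>. majorant \<Psi> a b X w)"
    proof (cases "R = 0 \<or> (\<exists>\<beta>\<in>\<Psi>. cpair \<beta> a b = 0)")
      case True
      then have "alternant \<Psi> a b X = 0"
      proof
        assume "R = 0"
        then show ?thesis using \<alpha>0 alternant_eq_0_spatial[OF \<alpha>0(1) nz[OF \<alpha>0(1)]] by simp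
      next
        assume "\<exists>\<beta>\<in>\<Psi>. cpair \<beta> a b = 0"
        then obtain \<beta> where "\<beta> \<in> \<Psi>" "cpair \<beta> a b = 0" by blast
        then show ?thesis by (intro alternant_eq_0_spectral[of \<beta>] nz)
      qed
      then show ?thesis using rhs by simp
    next
      case False
      then have R: "R > 0" and nonzero: "\<And>\<beta>. \<beta> \<in> \<Psi> \<Longrightarrow> cpair \<beta> a b \<noteq> 0" using \<alpha>0(2) by auto
      obtain \<theta>J where \<theta>J: "\<eta> \<le> \<theta>J" "\<theta>J < 1"
          "\<And>\<alpha>. \<alpha> \<in> \<Psi> \<Longrightarrow> \<bar>\<alpha> \<bullet> X\<bar> / R \<le> (1 + N) * \<theta>J \<Longrightarrow> \<bar>\<alpha> \<bullet> X\<bar> / R \<le> \<theta>J"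
        using gap[of "\<lambda>\<alpha>. \<bar>\<alpha> \<bullet> X\<bar> / R"] by blast
      obtain \<theta>K where \<theta>K: "\<eta> \<le> \<theta>K" "\<theta>K < 1"
          "\<And>\<beta>. \<beta> \<in> \<Psi> \<Longrightarrow> cmod (cpair \<beta> a b) * R \<le> (1 + N) * \<theta>K \<Longrightarrow> cmod (cpair \<beta> a b) * R \<le> \<theta>K"
        using gap[of "\<lambda>\<beta>. cmod (cpair \<beta> a b) * R"] by blast
      define J where "J = {\<alpha> \<in> \<Psi>. \<bar>\<alpha> \<bullet> X\<bar> \<le> \<theta>J * R}"
      define K where "K = {\<beta> \<in> \<Psi>. cmod (cpair \<beta> a b) * R \<le> \<theta>K}"
      have N\<Psi>: "\<bar>\<beta> \<bullet> coroot \<alpha>\<bar> \<le> N" "\<bar>\<alpha> \<bullet> \<beta>\<bar> \<le> N" if "\<alpha> \<in> \<Psi>" "\<beta> \<in> \<Psi>" for \<alpha> \<beta>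
        using N(2) that sub by blast+
      have closedJ: "reflection_closed J"
      proof -
        have "reflection_closed {\<alpha> \<in> \<Psi>. \<bar>\<alpha> \<bullet> X\<bar> / R \<le> \<theta>J}"
        proof (rule subadditive_sublevel_closed[OF sub closed])
          show "\<bar>reflection \<alpha> \<beta> \<bullet> X\<bar> / R \<le> \<bar>\<beta> \<bullet> X\<bar> / R + N * (\<bar>\<alpha> \<bullet> X\<bar> / R)" if "\<alpha> \<in> \<Psi>" "\<beta> \<in> \<Psi>" for \<alpha> \<beta>
            using divide_right_mono[OF spatial_subadditive[OF N\<Psi>(1)[OF that], of X], of R] R
            by (simp add: add_divide_distrib)
        qed (use N(1) \<theta>J(3) in auto)
        then show ?thesis using R by (simp add: J_def field_simps)
      qed
      have closedK: "reflection_closed K"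
        unfolding K_def
      proof (rule subadditive_sublevel_closed[OF sub closed])
        show "cmod (cpair (reflection \<alpha> \<beta>) a b) * R \<le> cmod (cpair \<beta> a b) * R + N * (cmod (cpair \<alpha> a b) * R)"
          if "\<alpha> \<in> \<Psi>" "\<beta> \<in> \<Psi>" for \<alpha> \<beta>
          using mult_right_mono[OF spectral_subadditive[OF N\<Psi>(1)[OF that], of a b], of R] R
          by (simp add: distrib_right mult.assoc)
      qed (use N(1) \<theta>K(3) in auto)
      have "\<alpha>0 \<notin> J" using \<alpha>0(2) \<theta>J(2) R by (simp add: J_def)
      then have J: "J \<subset> \<Psi>" using \<alpha>0(1) by (auto simp: J_def)
      have K: "K \<subseteq> \<Psi>" by (auto simp: K_def)
      have WJ: "weyl_group J \<subseteq> weyl_group \<Psi>" and WK: "weyl_group K \<subseteq> weyl_group \<Psi>"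
        using J K weyl_mono by blast+
      define Mr where "Mr u = (\<Prod>\<alpha>\<in>J \<inter> P. min 1 (\<bar>\<alpha> \<bullet> X\<bar> * (cmod (cpair \<alpha> (u a) (u b)) + D / R)))" for u
      \<comment> \<open>the induction hypothesis at a shifted parameter, with the shift absorbed into \<open>D / R\<close>\<close>
      have shift: "cmod (alternant J (u (a + Re z *\<^sub>R v)) (u (b + Im z *\<^sub>R v)) X)
          \<le> C1 * (\<Sum>j\<in>weyl_group J. Mr (j \<circ> u))"
        if u: "u \<in> weyl_group \<Psi>" and t: "\<forall>\<beta>\<in>\<Psi>. \<bar>t \<beta>\<bar> \<le> 1" and z: "cmod z \<le> 3 / (\<kappa> * R)"
          and v: "v = (\<Sum>\<gamma>\<in>\<Psi>. t \<gamma> *\<^sub>R \<gamma>)" for u t z v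
      proof -
        have inner_v: "\<bar>x \<bullet> w v\<bar> \<le> n * B"
          if w: "w \<in> weyl_group \<Psi>" and B: "\<And>\<gamma>. \<gamma> \<in> \<Psi> \<Longrightarrow> \<bar>\<gamma> \<bullet> x\<bar> \<le> B" for w x B
        proof -
          have "x \<bullet> w v = (\<Sum>\<gamma>\<in>\<Psi>. t \<gamma> * (x \<bullet> w \<gamma>))"
            using weyl_linear[OF w] by (simp add: v linear_sum linear_scale inner_sum_right)
          also have "\<bar>\<dots>\<bar> \<le> (\<Sum>\<gamma>\<in>\<Psi>. B)"
          proof (rule order_trans[OF sum_abs sum_mono])
            fix \<gamma> assume \<gamma>: "\<gamma> \<in> \<Psi>"
            have "\<bar>t \<gamma>\<bar> * \<bar>w \<gamma> \<bullet> x\<bar> \<le> 1 * B"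
              using t \<gamma> B weyl_maps_roots[OF closed w \<gamma>] by (intro mult_mono) auto
            then show "\<bar>t \<gamma> * (x \<bullet> w \<gamma>)\<bar> \<le> B" by (simp add: abs_mult inner_commute)
          qed
          finally show ?thesis by (simp add: n_def)
        qed
        have J_bound: "euclidean_bound J c' C1" using C1(2) J closedJ by blast
        have "\<bar>w (u (b + Im z *\<^sub>R v)) \<bullet> X\<bar> \<le> c'" if "w \<in> weyl_group J" for w
        proof -
          have wu: "w \<circ> u \<in> weyl_group \<Psi>" using that u WJ weyl_comp by blast
          have "w (u (b + Im z *\<^sub>R v)) = (w \<circ> u) b + Im z *\<^sub>R (w \<circ> u) v"
            using linear_add[OF weyl_linear[OF wu], of b "Im z *\<^sub>R v"] linear_scale[OF weyl_linear[OF wu], of "Im z" v]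
            by simp
          then have "w (u (b + Im z *\<^sub>R v)) \<bullet> X = (w \<circ> u) b \<bullet> X + Im z * (X \<bullet> (w \<circ> u) v)"
            by (simp add: inner_add_left inner_commute[of _ X] inner_add_right)
          then have "\<bar>w (u (b + Im z *\<^sub>R v)) \<bullet> X\<bar> \<le> \<bar>(w \<circ> u) b \<bullet> X\<bar> + \<bar>Im z\<bar> * \<bar>X \<bullet> (w \<circ> u) v\<bar>"
            by (simp only: abs_mult[symmetric] abs_triangle_ineq)
          moreover have "\<bar>(w \<circ> u) b \<bullet> X\<bar> \<le> c" using imag wu by blast
          moreover have "\<bar>Im z\<bar> * \<bar>X \<bullet> (w \<circ> u) v\<bar> \<le> 3 / (\<kappa> * R) * (n * R)"
            using inner_v[OF wu, of X R] R_ge z abs_Im_le_cmod[of z] \<kappa> R by (intro mult_mono) auto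
          moreover have "3 / (\<kappa> * R) * (n * R) = 3 * n / \<kappa>" using R by simp
          ultimately show ?thesis unfolding c'_def by linarith
        qed
        then have "cmod (alternant J (u (a + Re z *\<^sub>R v)) (u (b + Im z *\<^sub>R v)) X)
            \<le> C1 * (\<Sum>j\<in>weyl_group J. majorant J (u (a + Re z *\<^sub>R v)) (u (b + Im z *\<^sub>R v)) X j)"
          using J_bound unfolding euclidean_bound_def by blast
        also have "\<dots> \<le> C1 * (\<Sum>j\<in>weyl_group J. Mr (j \<circ> u))"
        proof (intro mult_left_mono sum_mono C1(1))
          fix j assume j: "j \<in> weyl_group J"
          then have ju: "j \<circ> u \<in> weyl_group \<Psi>" using u WJ weyl_comp by blast
          show "majorant J (u (a + Re z *\<^sub>R v)) (u (b + Im z *\<^sub>R v)) X j \<le> Mr (j \<circ> u)"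
            unfolding majorant_def Mr_def
          proof (rule prod_mono, rule conjI)
            fix \<alpha> assume "\<alpha> \<in> J \<inter> P"
            then have \<alpha>: "\<alpha> \<in> \<Psi>" using J by blast
            have "cpair \<alpha> (j (u (a + Re z *\<^sub>R v))) (j (u (b + Im z *\<^sub>R v)))
                = cpair \<alpha> ((j \<circ> u) a) ((j \<circ> u) b) + z * of_real (\<alpha> \<bullet> (j \<circ> u) v)"
              using cpair_weyl_line[OF weyl_linear[OF ju]] by simp
            then have "cmod (cpair \<alpha> (j (u (a + Re z *\<^sub>R v))) (j (u (b + Im z *\<^sub>R v))))
                \<le> cmod (cpair \<alpha> ((j \<circ> u) a) ((j \<circ> u) b)) + cmod z * \<bar>\<alpha> \<bullet> (j \<circ> u) v\<bar>"
              by (metis norm_mult norm_of_real norm_triangle_ineq)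
            also have "cmod z * \<bar>\<alpha> \<bullet> (j \<circ> u) v\<bar> \<le> 3 / (\<kappa> * R) * (n * N)"
              using inner_v[OF ju, of \<alpha> N] N\<Psi>(2)[OF _ \<alpha>] z \<kappa> R by (intro mult_mono) auto
            also have "3 / (\<kappa> * R) * (n * N) = D / R" by (simp add: D_def)
            finally show "min 1 (\<bar>\<alpha> \<bullet> X\<bar> * cmod (cpair \<alpha> (j (u (a + Re z *\<^sub>R v))) (j (u (b + Im z *\<^sub>R v)))))
                \<le> min 1 (\<bar>\<alpha> \<bullet> X\<bar> * (cmod (cpair \<alpha> ((j \<circ> u) a) ((j \<circ> u) b)) + D / R))"
              by (intro min.mono mult_left_mono) auto
          qed auto
        qed
        finally show ?thesis .
      qed
      show ?thesis
        unfolding sum_distrib_left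
      proof (rule alternant_bound_by_double_cosets[OF finW _ K])
        show "J \<subseteq> \<Psi>" using J by blast
        fix w assume w: "w \<in> weyl_group \<Psi>"
        define G where "G a b = (\<Sum>k\<in>weyl_group K. of_real (det (matrix k)) * alternant J (w (k a)) (w (k b)) X)" for a b
        define B where "B = (\<Sum>k\<in>weyl_group K. C1 * (\<Sum>j\<in>weyl_group J. Mr (j \<circ> (w \<circ> k))))"
        have wk: "w \<circ> k \<in> weyl_group \<Psi>" if "k \<in> weyl_group K" for k using that w WK weyl_comp by blast
        have "cmod (G a b) \<le> (\<Prod>\<beta>\<in>K \<inter> P. cmod (cpair \<beta> a b) * R) * B"
        proof (rule division[rule_format, OF K R])
          show "cpair \<beta> a b \<noteq> 0 \<and> cmod (cpair \<beta> a b) * R \<le> 1" if "\<beta> \<in> K" for \<beta>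
            using that nonzero \<theta>K(2) by (auto simp: K_def)
          show "(\<lambda>z. G (a + Re z *\<^sub>R v) (b + Im z *\<^sub>R v)) holomorphic_on UNIV" for v
            unfolding G_def
          proof (intro holomorphic_intros)
            fix k assume "k \<in> weyl_group K"
            then show "(\<lambda>z. alternant J (w (k (a + Re z *\<^sub>R v))) (w (k (b + Im z *\<^sub>R v))) X) holomorphic_on UNIV"
              using holomorphic_alternant_line[OF weyl_linear[OF wk]] by simp
          qed
          show "G a' b' = 0" if "\<beta> \<in> K" "cpair \<beta> a' b' = 0" for \<beta> a' b'
            unfolding G_def
            using that nz[of \<beta>] K
            by (intro weyl_sum_right_invariant[of \<beta>]) (auto simp: cpair_eq_0_iff reflection_fixes)
          show "cmod (G (a + Re z *\<^sub>R (\<Sum>\<gamma>\<in>\<Psi>. t \<gamma> *\<^sub>R \<gamma>)) (b + Im z *\<^sub>R (\<Sum>\<gamma>\<in>\<Psi>. t \<gamma> *\<^sub>R \<gamma>))) \<le> B"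
            if "\<And>\<beta>. \<beta> \<in> \<Psi> \<Longrightarrow> \<bar>t \<beta>\<bar> \<le> 1" "cmod z \<le> 3 / (\<kappa> * R)" for t z
            unfolding G_def B_def
          proof (rule sum_norm_le)
            fix k assume k: "k \<in> weyl_group K"
            show "cmod (of_real (det (matrix k)) * alternant J
                (w (k (a + Re z *\<^sub>R (\<Sum>\<gamma>\<in>\<Psi>. t \<gamma> *\<^sub>R \<gamma>)))) (w (k (b + Im z *\<^sub>R (\<Sum>\<gamma>\<in>\<Psi>. t \<gamma> *\<^sub>R \<gamma>)))) X)
              \<le> C1 * (\<Sum>j\<in>weyl_group J. Mr (j \<circ> (w \<circ> k)))"
              using shift[OF wk[OF k], of t z] that by (simp add: norm_mult abs_det_weyl[OF k])
          qed
        qed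
        also have "\<dots> = (\<Sum>k\<in>weyl_group K. \<Sum>j\<in>weyl_group J.
            C1 * ((\<Prod>\<beta>\<in>K \<inter> P. cmod (cpair \<beta> a b) * R) * Mr (j \<circ> w \<circ> k)))"
          unfolding B_def by (simp add: sum_distrib_left mult.left_commute comp_assoc)
        also have "\<dots> \<le> (\<Sum>k\<in>weyl_group K. \<Sum>j\<in>weyl_group J. C1 * C2 * majorant \<Psi> a b X (j \<circ> w \<circ> k))"
        proof (intro sum_mono)
          fix k j assume "k \<in> weyl_group K" "j \<in> weyl_group J"
          then have u: "j \<circ> w \<circ> k \<in> weyl_group \<Psi>" using w WJ WK weyl_comp by blast
          have "(\<Prod>\<beta>\<in>K \<inter> P. cmod (cpair \<beta> a b) * R) * Mr (j \<circ> w \<circ> k) \<le> C2 * majorant \<Psi> a b X (j \<circ> w \<circ> k)"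
            unfolding Mr_def C2_def
            by (rule comparison_product[OF sub u closed J_def K_def closedK \<eta> \<theta>J(1) \<theta>K(1) _ D R R_ge])
               (use \<theta>K(2) in auto)
          from mult_left_mono[OF this C1(1)]
          show "C1 * ((\<Prod>\<beta>\<in>K \<inter> P. cmod (cpair \<beta> a b) * R) * Mr (j \<circ> w \<circ> k))
              \<le> C1 * C2 * majorant \<Psi> a b X (j \<circ> w \<circ> k)" by (simp add: mult.assoc)
        qed
        finally show "cmod (\<Sum>k\<in>weyl_group K. of_real (det (matrix k)) * alternant J (w (k a)) (w (k b)) X)
          \<le> (\<Sum>k\<in>weyl_group K. \<Sum>j\<in>weyl_group J. C1 * C2 * majorant \<Psi> a b X (j \<circ> w \<circ> k))"
          unfolding G_def .
      qed
    qed
  qed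
  then show ?thesis by blast
qed

lemma euclidean_bound_exists:
  assumes "\<Psi> \<subseteq> \<Phi>" "reflection_closed \<Psi>"
  shows "\<exists>C. euclidean_bound \<Psi> c C"
proof -
  have "finite \<Psi>" by (rule finite_subset[OF assms(1) finite_roots])
  then show ?thesis using assms
  proof (induction \<Psi> arbitrary: c rule: finite_psubset_induct)
    case (psubset \<Psi>)
    show ?case
    proof (cases "\<Psi> = {}")
      case True
      then show ?thesis using euclidean_bound_empty by simp
    next
      case False
      show ?thesis
      proof (rule euclidean_bound_step[OF psubset.prems False])
        show "\<exists>C. euclidean_bound J c C" if "J \<subset> \<Psi>" "reflection_closed J" for J c
          using psubset.IH[OF that(1) _ that(2)] that(1) psubset.prems(1) by blast
      qed
    qed
  qed
qed

end

section \<open>Lifting from the torus to its tangent space\<close>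

lemma coroot_orthogonal:
  assumes "orthogonal_transformation w"
  shows "coroot (w \<alpha>) = w (coroot \<alpha>)"
  using assms by (simp add: coroot_def orthogonal_transformation_def linear_scale)

lemma coroot_reflection: "coroot (reflection \<alpha> \<gamma>) = reflection \<alpha> (coroot \<gamma>)"
  by (rule coroot_orthogonal[OF orthogonal_transformation_reflection])

lemma reflection_bij_betw:
  assumes "reflection_closed J" "\<alpha> \<in> J"
  shows "bij_betw (reflection \<alpha>) J J"
  using assms by (intro bij_betw_byWitness[where f' = "reflection \<alpha>"])
    (auto simp: reflection_involution reflection_closed_def)

text \<open>The operator \<open>T\<close> commutes with the reflections, hence maps \<open>\<alpha>\<close> to a multiple \<open>e \<alpha> > 0\<close> of itself; it
  is self-adjoint, so \<open>e\<close> agrees on roots that are not orthogonal.  The vector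
  \<open>Y = (\<Sum>\<gamma>\<in>J. (x \<gamma> / e \<gamma>) *\<^sub>R coroot \<gamma>)\<close> is the value of the inverse of \<open>T\<close> at the vector that \<open>x\<close> suggests.  The
  cocycle relation determines how \<open>reflection \<alpha>\<close> moves \<open>Y\<close>, and thereby the value
  \<open>\<alpha> \<bullet> Y\<close>.\<close>

lemma reflection_cocycle_linear:
  fixes x :: "real ^ 'n \<Rightarrow> real"
  assumes fin: "finite J" and closed: "reflection_closed J"
    and cocycle: "\<And>\<alpha> \<gamma>. \<alpha> \<in> J \<Longrightarrow> \<gamma> \<in> J \<Longrightarrow> x (reflection \<alpha> \<gamma>) = x \<gamma> - (\<gamma> \<bullet> coroot \<alpha>) * x \<alpha>"
  shows "\<exists>X. \<forall>\<alpha>\<in>J. \<alpha> \<bullet> X = x \<alpha>"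
proof -
  have nz: "\<alpha> \<noteq> 0" if "\<alpha> \<in> J" for \<alpha> using that closed by (auto simp: reflection_closed_def)
  define T where "T v = (\<Sum>\<gamma>\<in>J. (\<gamma> \<bullet> v) *\<^sub>R coroot \<gamma>)" for v
  have T_scale: "T (c *\<^sub>R v) = c *\<^sub>R T v" for c v
    by (simp add: T_def scaleR_sum_right)
  have T_self_adjoint: "T v \<bullet> u = v \<bullet> T u" for v u
    by (simp add: T_def inner_sum_left inner_sum_right coroot_def inner_commute mult.left_commute mult.commute)
  have T_reflection: "reflection \<alpha> (T v) = T (reflection \<alpha> v)" if "\<alpha> \<in> J" for \<alpha> v
  proof -
    have "T (reflection \<alpha> v) = (\<Sum>\<gamma>\<in>J. (reflection \<alpha> \<gamma> \<bullet> reflection \<alpha> v) *\<^sub>R coroot (reflection \<alpha> \<gamma>))"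
      unfolding T_def
      using sum.reindex_bij_betw[OF reflection_bij_betw[OF closed that], of "\<lambda>\<gamma>. (\<gamma> \<bullet> reflection \<alpha> v) *\<^sub>R coroot \<gamma>"]
      by simp
    also have "\<dots> = reflection \<alpha> (T v)"
      by (simp add: T_def coroot_reflection linear_sum[OF linear_reflection] linear_scale[OF linear_reflection]
          inner_reflection_commute reflection_involution)
    finally show ?thesis by simp
  qed
  define e where "e \<alpha> = (T \<alpha> \<bullet> coroot \<alpha>) / 2" for \<alpha>
  have T_root: "T \<alpha> = e \<alpha> *\<^sub>R \<alpha>" if "\<alpha> \<in> J" for \<alpha>
  proof -
    have "T \<alpha> - (T \<alpha> \<bullet> coroot \<alpha>) *\<^sub>R \<alpha> = T (- \<alpha>)"
      using T_reflection[OF that, of \<alpha>] by (simp add: reflection_self) (simp add: reflection_def)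
    also have "\<dots> = - T \<alpha>" using T_scale[of "-1" \<alpha>] by simp
    finally have "2 *\<^sub>R T \<alpha> = (T \<alpha> \<bullet> coroot \<alpha>) *\<^sub>R \<alpha>" by (simp add: scaleR_2 algebra_simps)
    then have "(1/2) *\<^sub>R (2 *\<^sub>R T \<alpha>) = (1/2) *\<^sub>R ((T \<alpha> \<bullet> coroot \<alpha>) *\<^sub>R \<alpha>)" by simp
    then show ?thesis by (simp add: e_def)
  qed
  have e_pos: "e \<alpha> > 0" if "\<alpha> \<in> J" for \<alpha>
  proof -
    have "T \<alpha> \<bullet> \<alpha> = (\<Sum>\<gamma>\<in>J. 2 * (\<gamma> \<bullet> \<alpha>)\<^sup>2 / (\<gamma> \<bullet> \<gamma>))"
      by (simp add: T_def inner_sum_left coroot_def power2_eq_square mult_ac)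
    also have "\<dots> > 0"
      using fin that nz by (intro sum_pos2[of _ \<alpha>]) auto
    finally have "0 < e \<alpha> * (\<alpha> \<bullet> \<alpha>)" using T_root[OF that] by simp
    then show ?thesis by (rule zero_less_mult_pos2) (use nz[OF that] in simp)
  qed
  have e_eq: "e \<alpha> = e \<gamma>" if "\<alpha> \<in> J" "\<gamma> \<in> J" "\<gamma> \<bullet> \<alpha> \<noteq> 0" for \<alpha> \<gamma>
    using T_self_adjoint[of \<alpha> \<gamma>] that by (simp add: T_root inner_commute)
  have e_reflection: "e (reflection \<alpha> \<gamma>) = e \<gamma>" if "\<alpha> \<in> J" "\<gamma> \<in> J" for \<alpha> \<gamma>
  proof -
    have mem: "reflection \<alpha> \<gamma> \<in> J" using that closed by (auto simp: reflection_closed_def)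
    have "e (reflection \<alpha> \<gamma>) *\<^sub>R reflection \<alpha> \<gamma> = e \<gamma> *\<^sub>R reflection \<alpha> \<gamma>"
      using T_reflection[OF that(1), of \<gamma>] T_root[OF that(2)] T_root[OF mem]
      by (metis linear_scale[OF linear_reflection])
    then show ?thesis using nz[OF mem] by simp
  qed
  define Y where "Y = (\<Sum>\<gamma>\<in>J. (x \<gamma> / e \<gamma>) *\<^sub>R coroot \<gamma>)"
  have "\<alpha> \<bullet> Y = x \<alpha>" if \<alpha>: "\<alpha> \<in> J" for \<alpha>
  proof -
    have "reflection \<alpha> Y = (\<Sum>\<gamma>\<in>J. (x \<gamma> / e \<gamma>) *\<^sub>R coroot (reflection \<alpha> \<gamma>))"
      by (simp add: Y_def linear_sum[OF linear_reflection] linear_scale[OF linear_reflection] coroot_reflection)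
    also have "\<dots> = (\<Sum>\<gamma>\<in>J. (x (reflection \<alpha> \<gamma>) / e (reflection \<alpha> \<gamma>)) *\<^sub>R coroot (reflection \<alpha> (reflection \<alpha> \<gamma>)))"
      using sum.reindex_bij_betw[OF reflection_bij_betw[OF closed \<alpha>],
          of "\<lambda>\<gamma>. (x \<gamma> / e \<gamma>) *\<^sub>R coroot (reflection \<alpha> \<gamma>)"] by simp
    also have "\<dots> = (\<Sum>\<gamma>\<in>J. (x \<gamma> / e \<gamma>) *\<^sub>R coroot \<gamma> - (x \<alpha> / e \<alpha>) *\<^sub>R ((\<gamma> \<bullet> coroot \<alpha>) *\<^sub>R coroot \<gamma>))"
    proof (rule sum.cong[OF refl])
      fix \<gamma> assume \<gamma>: "\<gamma> \<in> J"
      show "(x (reflection \<alpha> \<gamma>) / e (reflection \<alpha> \<gamma>)) *\<^sub>R coroot (reflection \<alpha> (reflection \<alpha> \<gamma>))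
        = (x \<gamma> / e \<gamma>) *\<^sub>R coroot \<gamma> - (x \<alpha> / e \<alpha>) *\<^sub>R ((\<gamma> \<bullet> coroot \<alpha>) *\<^sub>R coroot \<gamma>)"
      \<comment> \<open>in the orthogonal case \<open>e \<gamma>\<close> and \<open>e \<alpha>\<close> may differ, but the correction term vanishes\<close>
      proof (cases "\<gamma> \<bullet> \<alpha> = 0")
        case True
        then show ?thesis
          by (simp add: cocycle[OF \<alpha> \<gamma>] e_reflection[OF \<alpha> \<gamma>] reflection_involution inner_coroot)
      next
        case False
        then show ?thesis
          by (simp add: cocycle[OF \<alpha> \<gamma>] e_reflection[OF \<alpha> \<gamma>] reflection_involution e_eq[OF \<alpha> \<gamma>]
              diff_divide_distrib scaleR_left_diff_distrib mult.commute)
      qed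
    qed
    also have "\<dots> = Y - (x \<alpha> / e \<alpha>) *\<^sub>R T (coroot \<alpha>)"
      by (simp add: sum_subtractf Y_def T_def scaleR_sum_right)
    also have "T (coroot \<alpha>) = e \<alpha> *\<^sub>R coroot \<alpha>"
      by (simp add: coroot_def T_scale T_root[OF \<alpha>])
    finally have "reflection \<alpha> Y = Y - x \<alpha> *\<^sub>R coroot \<alpha>" using e_pos[OF \<alpha>] by simp
    moreover have "reflection \<alpha> Y = Y - (\<alpha> \<bullet> Y) *\<^sub>R coroot \<alpha>"
      by (simp add: reflection_def coroot_def inner_commute)
    ultimately have "x \<alpha> *\<^sub>R coroot \<alpha> = (\<alpha> \<bullet> Y) *\<^sub>R coroot \<alpha>" by (metis add_diff_cancel_left' diff_add_cancel)
    then show ?thesis using nz[OF \<alpha>] by (simp add: coroot_def)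
  qed
  then show ?thesis by blast
qed

definition angle_mod :: "real \<Rightarrow> real" where
  "angle_mod t = t - 2 * pi * of_int (round (t / (2 * pi)))"

lemma angle_mod_congruent: "\<exists>k::int. t = angle_mod t + 2 * pi * of_int k"
  by (rule exI[of _ "round (t / (2 * pi))"]) (simp add: angle_mod_def)

text \<open>For the representative closest to zero this is concavity of the sine on \<open>{0..pi}\<close>.\<close>

lemma abs_angle_mod_le: "\<bar>angle_mod t\<bar> \<le> pi * \<bar>sin (t / 2)\<bar>"
proof -
  define s where "s = angle_mod t"
  define k where "k = round (t / (2 * pi))"
  have t: "t = s + 2 * pi * of_int k" by (simp add: s_def k_def angle_mod_def)
  have "\<bar>of_int k - t / (2 * pi)\<bar> \<le> 1 / 2" unfolding k_def by (rule of_int_round_abs_le)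
  moreover have "of_int k - t / (2 * pi) = - s / (2 * pi)" by (simp add: t field_simps)
  ultimately have "\<bar>s\<bar> / (2 * pi) \<le> 1 / 2" by simp
  then have s: "\<bar>s\<bar> \<le> pi" using pi_gt_zero by (simp add: pos_divide_le_eq)
  have "t / 2 = s / 2 + pi * of_int k" by (simp add: t field_simps)
  then have "\<bar>sin (t / 2)\<bar> = \<bar>sin (s / 2)\<bar>"
    by (simp only: sin_add sin_npi_int cos_npi_int abs_mult) simp
  also have "\<dots> = sin (\<bar>s\<bar> / 2)"
  proof -
    have "0 \<le> sin (\<bar>s\<bar> / 2)" using s by (intro sin_ge_zero) auto
    then show ?thesis by (cases "s \<ge> 0") (auto simp: abs_if)
  qed
  finally have "\<bar>sin (t / 2)\<bar> = sin (\<bar>s\<bar> / 2)" .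
  moreover have "\<bar>s\<bar> / pi \<le> sin (\<bar>s\<bar> / 2)"
  proof -
    have "convex_on {0..pi} (\<lambda>x. - sin x)"
      by (rule f''_ge0_imp_convex[where f' = "\<lambda>x. - cos x" and f'' = sin])
         (auto intro!: derivative_eq_intros sin_ge_zero)
    from convex_onD[OF this, of "\<bar>s\<bar> / pi" 0 "pi / 2"] show ?thesis using s by simp
  qed
  ultimately show ?thesis by (simp add: s_def field_simps)
qed

context positive_root_system
begin

lemma regular_integral_weyl:
  assumes "regular_integral \<Phi> \<mu>" "w \<in> weyl_group \<Phi>"
  shows "regular_integral \<Phi> (w \<mu>)"
  unfolding regular_integral_def
proof
  fix \<alpha> assume \<alpha>: "\<alpha> \<in> \<Phi>"
  obtain u where u: "u \<in> weyl_group \<Phi>" "\<And>x y. x \<bullet> w y = u x \<bullet> y"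
    using weyl_adjoint[OF assms(2)] by blast
  have "w \<mu> \<bullet> coroot \<alpha> = \<mu> \<bullet> coroot (u \<alpha>)"
    using u(2)[of "coroot \<alpha>" \<mu>] coroot_orthogonal[OF weyl_orthogonal[OF u(1)]] by (simp add: inner_commute)
  moreover have "u \<alpha> \<in> \<Phi>" by (rule weyl_maps_roots[OF reflection_closed_roots u(1) \<alpha>])
  ultimately show "w \<mu> \<bullet> coroot \<alpha> \<in> \<int> - {0}" using assms(1) by (simp add: regular_integral_def)
qed

lemma inner_coroot_Ints: "\<alpha> \<in> \<Phi> \<Longrightarrow> \<beta> \<in> \<Phi> \<Longrightarrow> \<beta> \<bullet> coroot \<alpha> \<in> \<int>"
  using root_system unfolding root_system_def by blast

text \<open>For integral \<open>\<nu>\<close> the orbit of \<open>\<nu>\<close> stays in one coset of the lattice spanned by \<open>J\<close>, so a translation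
  on which \<open>J\<close> takes values in the multiples of \<open>2 * pi\<close> multiplies all exponentials by the same phase.\<close>

lemma alternant_translate:
  assumes "J \<subseteq> \<Phi>" and lattice: "\<And>\<alpha>. \<alpha> \<in> J \<Longrightarrow> \<exists>k::int. \<alpha> \<bullet> Z = 2 * pi * of_int k"
    and reg: "regular_integral \<Phi> \<nu>"
  shows "cmod (alternant J \<nu> 0 (X + Z)) = cmod (alternant J \<nu> 0 X)"
proof -
  have orbit: "\<exists>k::int. w \<nu> \<bullet> Z = \<nu> \<bullet> Z + 2 * pi * of_int k" if "w \<in> weyl_group J" for w
    using that
  proof (induction rule: weyl_group.induct)
    case weyl_id
    show ?case by (rule exI[of _ 0]) simp
  next
    case (weyl_reflection \<alpha> w)
    obtain k where k: "w \<nu> \<bullet> Z = \<nu> \<bullet> Z + 2 * pi * of_int k" using weyl_reflection.IH by blast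
    obtain l where l: "\<alpha> \<bullet> Z = 2 * pi * of_int l" using lattice weyl_reflection.hyps(1) by blast
    have "w \<in> weyl_group \<Phi>" using weyl_mono[OF assms(1)] weyl_reflection.hyps(2) by blast
    then have "w \<nu> \<bullet> coroot \<alpha> \<in> \<int>"
      using regular_integral_weyl[OF reg] weyl_reflection.hyps(1) assms(1) by (auto simp: regular_integral_def)
    then obtain m where m: "w \<nu> \<bullet> coroot \<alpha> = of_int m" by (elim Ints_cases)
    have "(reflection \<alpha> \<circ> w) \<nu> \<bullet> Z = \<nu> \<bullet> Z + 2 * pi * of_int (k - m * l)"
      by (simp add: reflection_def inner_diff_left k l m algebra_simps)
    then show ?case by blast
  qed
  have "exp (\<i> * cpair (X + Z) (w \<nu>) (w 0)) = exp (\<i> * of_real (\<nu> \<bullet> Z)) * exp (\<i> * cpair X (w \<nu>) (w 0))"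
    if w: "w \<in> weyl_group J" for w
  proof -
    obtain k where k: "w \<nu> \<bullet> Z = \<nu> \<bullet> Z + 2 * pi * of_int k" using orbit[OF w] by blast
    have "\<i> * cpair (X + Z) (w \<nu>) (w 0)
        = (\<i> * of_real (\<nu> \<bullet> Z) + \<i> * cpair X (w \<nu>) (w 0)) + (of_int (2 * k) * pi) * \<i>"
      using k linear_0[OF weyl_linear[OF w]]
      by (simp add: cpair_def complex_eq_iff inner_add_left inner_commute[of Z])
    then show ?thesis unfolding exp_add[symmetric] exp_eq by blast
  qed
  then have "alternant J \<nu> 0 (X + Z) = exp (\<i> * of_real (\<nu> \<bullet> Z)) * alternant J \<nu> 0 X"
    by (simp add: alternant_def sum_distrib_left mult.left_commute)
  then show ?thesis by (simp add: norm_mult)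
qed

text \<open>The integrality of \<open>m = \<beta> \<bullet> coroot \<alpha>\<close> enters through \<open>\<bar>sin (m * t)\<bar> \<le> \<bar>m\<bar> * \<bar>sin t\<bar>\<close>.\<close>

lemma root_dist_subadditive:
  assumes "\<alpha> \<in> \<Phi>" "\<beta> \<in> \<Phi>" "\<bar>\<beta> \<bullet> coroot \<alpha>\<bar> \<le> N"
  shows "root_dist (reflection \<alpha> \<beta>) H \<le> root_dist \<beta> H + N * root_dist \<alpha> H"
proof -
  have "\<beta> \<bullet> coroot \<alpha> \<in> \<int>" using assms(1,2) by (rule inner_coroot_Ints)
  then obtain m where m: "\<beta> \<bullet> coroot \<alpha> = of_int m" by (elim Ints_cases)
  have nat_bound: "\<bar>sin (real n * t)\<bar> \<le> real n * \<bar>sin t\<bar>" for n and t :: real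
  proof (induction n)
    case (Suc n)
    have "\<bar>sin (real (Suc n) * t)\<bar> \<le> \<bar>sin t * cos (real n * t)\<bar> + \<bar>cos t * sin (real n * t)\<bar>"
      using abs_triangle_ineq by (simp add: distrib_right sin_add)
    also have "\<dots> \<le> \<bar>sin t\<bar> * 1 + 1 * \<bar>sin (real n * t)\<bar>"
      unfolding abs_mult by (intro add_mono mult_mono) auto
    finally show ?case using Suc.IH by (simp add: distrib_right)
  qed simp
  have "\<bar>sin (of_int m * t)\<bar> = \<bar>sin (real (nat \<bar>m\<bar>) * t)\<bar>" for t :: real
    by (cases "m \<ge> 0") (simp_all add: of_nat_nat)
  then have int_bound: "\<bar>sin (of_int m * t)\<bar> \<le> \<bar>of_int m\<bar> * \<bar>sin t\<bar>" for t :: real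
    using nat_bound[of "nat \<bar>m\<bar>" t] by simp
  define s t where "s = \<beta> \<bullet> H / 2" and "t = \<alpha> \<bullet> H / 2"
  have "(reflection \<alpha> \<beta> \<bullet> H) / 2 = s - of_int m * t"
    by (simp add: reflection_def inner_diff_left m s_def t_def diff_divide_distrib)
  then have "root_dist (reflection \<alpha> \<beta>) H = \<bar>sin s * cos (of_int m * t) - cos s * sin (of_int m * t)\<bar>"
    unfolding root_dist_def by (simp only: sin_diff)
  also have "\<dots> \<le> \<bar>sin s\<bar> * \<bar>cos (of_int m * t)\<bar> + \<bar>cos s\<bar> * \<bar>sin (of_int m * t)\<bar>"
    unfolding abs_mult[symmetric] by (rule abs_triangle_ineq4)
  also have "\<dots> \<le> \<bar>sin s\<bar> * 1 + 1 * (\<bar>of_int m\<bar> * \<bar>sin t\<bar>)"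
    using int_bound by (intro add_mono mult_mono) auto
  also have "\<dots> \<le> \<bar>sin s\<bar> + N * \<bar>sin t\<bar>" using assms(3) m by (simp add: mult_right_mono)
  finally show ?thesis by (simp add: root_dist_def s_def t_def)
qed

text \<open>The reduced values \<open>x \<alpha>\<close> satisfy the cocycle relation modulo \<open>2 * pi\<close>.  The defect is less than
  \<open>2 * pi\<close> in absolute value because the values are small, hence it is zero.\<close>

lemma lift_to_tangent_space:
  assumes J: "J \<subseteq> \<Phi>" "reflection_closed J"
    and N: "\<And>\<alpha> \<beta>. \<alpha> \<in> J \<Longrightarrow> \<beta> \<in> J \<Longrightarrow> \<bar>\<beta> \<bullet> coroot \<alpha>\<bar> \<le> N"
    and small: "\<And>\<alpha>. \<alpha> \<in> J \<Longrightarrow> root_dist \<alpha> H \<le> \<theta>" "(2 + N) * \<theta> < 2"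
  shows "\<exists>X. (\<forall>\<alpha>\<in>J. \<bar>\<alpha> \<bullet> X\<bar> \<le> pi * root_dist \<alpha> H) \<and> (\<forall>\<alpha>\<in>J. \<exists>k::int. \<alpha> \<bullet> (H - X) = 2 * pi * of_int k)"
proof -
  define x where "x \<alpha> = angle_mod (\<alpha> \<bullet> H)" for \<alpha>
  have x_le: "\<bar>x \<alpha>\<bar> \<le> pi * root_dist \<alpha> H" for \<alpha>
    using abs_angle_mod_le by (simp add: x_def root_dist_def)
  have cocycle: "x (reflection \<alpha> \<gamma>) = x \<gamma> - (\<gamma> \<bullet> coroot \<alpha>) * x \<alpha>" if \<alpha>\<gamma>: "\<alpha> \<in> J" "\<gamma> \<in> J" for \<alpha> \<gamma>
  proof -
    have "\<gamma> \<bullet> coroot \<alpha> \<in> \<int>" using J(1) \<alpha>\<gamma> by (intro inner_coroot_Ints) auto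
    then obtain m where m: "\<gamma> \<bullet> coroot \<alpha> = of_int m" by (elim Ints_cases)
    obtain i j k where ijk: "\<alpha> \<bullet> H = x \<alpha> + 2 * pi * of_int i" "\<gamma> \<bullet> H = x \<gamma> + 2 * pi * of_int j"
        "reflection \<alpha> \<gamma> \<bullet> H = x (reflection \<alpha> \<gamma>) + 2 * pi * of_int k"
      unfolding x_def using angle_mod_congruent by metis
    have "reflection \<alpha> \<gamma> \<bullet> H = \<gamma> \<bullet> H - of_int m * (\<alpha> \<bullet> H)"
      by (simp add: reflection_def inner_diff_left m)
    then have diff: "x (reflection \<alpha> \<gamma>) - x \<gamma> + of_int m * x \<alpha> = 2 * pi * of_int (j - m * i - k)"
      unfolding ijk by (simp add: algebra_simps)
    have bound: "\<bar>x \<beta>\<bar> \<le> pi * \<theta>" if "\<beta> \<in> J" for \<beta>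
      using order_trans[OF x_le mult_left_mono[OF small(1)[OF that], of pi]] by simp
    have "reflection \<alpha> \<gamma> \<in> J" using \<alpha>\<gamma> J(2) by (auto simp: reflection_closed_def)
    then have "\<bar>x (reflection \<alpha> \<gamma>)\<bar> \<le> pi * \<theta>" "\<bar>x \<gamma>\<bar> \<le> pi * \<theta>" using bound \<alpha>\<gamma>(2) by auto
    moreover have "\<bar>of_int m * x \<alpha>\<bar> \<le> N * (pi * \<theta>)"
      unfolding abs_mult using N[OF \<alpha>\<gamma>] bound[OF \<alpha>\<gamma>(1)] m by (intro mult_mono) auto
    ultimately have "\<bar>2 * pi * of_int (j - m * i - k)\<bar> \<le> pi * ((2 + N) * \<theta>)"
      unfolding diff[symmetric] by (simp add: algebra_simps)
    also have "\<dots> < pi * 2" using small(2) by simp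
    finally have "pi * 2 * \<bar>of_int (j - m * i - k) :: real\<bar> < pi * 2 * 1" by (simp add: abs_mult mult_ac)
    then have "\<bar>of_int (j - m * i - k) :: real\<bar> < 1" by (subst (asm) mult_less_cancel_left_pos) auto
    then have "j - m * i - k = 0" by linarith
    then show ?thesis using diff by (simp add: m)
  qed
  have "finite J" by (rule finite_subset[OF J(1) finite_roots])
  from reflection_cocycle_linear[OF this J(2) cocycle]
  obtain X where X: "\<forall>\<alpha>\<in>J. \<alpha> \<bullet> X = x \<alpha>" by blast
  have "\<exists>k::int. \<alpha> \<bullet> (H - X) = 2 * pi * of_int k" if "\<alpha> \<in> J" for \<alpha>
  proof -
    obtain k where "\<alpha> \<bullet> H = x \<alpha> + 2 * pi * of_int k"
      unfolding x_def using angle_mod_congruent by blast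
    then have "\<alpha> \<bullet> (H - X) = 2 * pi * of_int k" using X that by (simp add: inner_diff_right)
    then show ?thesis by blast
  qed
  moreover have "\<bar>\<alpha> \<bullet> X\<bar> \<le> pi * root_dist \<alpha> H" if "\<alpha> \<in> J" for \<alpha>
    using X x_le[of \<alpha>] that by simp
  ultimately show ?thesis by blast
qed

section \<open>The estimate for the Weyl alternant\<close>

lemma weyl_alternant_eq: "weyl_alternant \<Phi> \<mu> H = alternant \<Phi> \<mu> 0 H"
proof -
  have "complex_of_real (w \<mu> \<bullet> H) = cpair H (w \<mu>) (w 0)" if "w \<in> weyl_group \<Phi>" for w
    using linear_0[OF weyl_linear[OF that]] by (simp add: cpair_def complex_eq_iff inner_commute)
  then show ?thesis by (simp add: weyl_alternant_def alternant_def)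
qed

text \<open>The decomposition by cosets of the group of \<open>J\<close> reduces the estimate to the alternants of
  \<open>J\<close>; it is the double coset bound with the second subset empty.\<close>

lemma weyl_alternant_bound:
  "\<exists>C>0. \<forall>\<mu> H. regular_integral \<Phi> \<mu> \<longrightarrow>
     cmod (weyl_alternant \<Phi> \<mu> H)
       \<le> C * (\<Sum>w\<in>weyl_group \<Phi>. \<Prod>\<alpha>\<in>P. min 1 (root_dist \<alpha> H * \<bar>w \<mu> \<bullet> coroot \<alpha>\<bar>))"
proof -
  obtain N where N: "N \<ge> 1" "\<And>\<alpha> \<beta>. \<alpha> \<in> \<Phi> \<Longrightarrow> \<beta> \<in> \<Phi> \<Longrightarrow> \<bar>\<beta> \<bullet> coroot \<alpha>\<bar> \<le> N \<and> \<bar>\<alpha> \<bullet> \<beta>\<bar> \<le> N"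
    using coroot_bound by blast
  define \<eta> where "\<eta> = 1 / (1 + N) ^ (card \<Phi> + 1)"
  have \<eta>: "\<eta> > 0" using N(1) by (simp add: \<eta>_def)
  have "\<exists>C\<ge>0. \<forall>J\<in>{J. J \<subseteq> \<Phi> \<and> reflection_closed J}. euclidean_bound J 0 C"
  proof (rule uniform_constant)
    show "finite {J. J \<subseteq> \<Phi> \<and> reflection_closed J}"
      by (rule finite_subset[OF _ finite_Pow_iff[THEN iffD2, OF finite_roots]]) auto
  qed (use euclidean_bound_exists euclidean_bound_mono in auto)
  then obtain C1 where C1: "C1 \<ge> 0" "\<And>J. J \<subseteq> \<Phi> \<Longrightarrow> reflection_closed J \<Longrightarrow> euclidean_bound J 0 C1"
    by blast
  define b where "b = pi * N + 1 / \<eta>"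
  have b: "b \<ge> 1" "b \<ge> pi * N" "b \<ge> 1 / \<eta>"
  proof -
    have "1 * 1 \<le> pi * N" using N(1) pi_ge_two by (intro mult_mono) auto
    then show "b \<ge> 1" "b \<ge> pi * N" "b \<ge> 1 / \<eta>" using \<eta> by (auto simp: b_def add_increasing2 add_increasing)
  qed
  have PP: "P \<subseteq> \<Phi>" using positive_system by (simp add: positive_system_def)
  then have finP: "finite P" by (rule finite_subset[OF _ finite_roots])
  define C where "C = (C1 + 1) * b ^ card P"
  have "C > 0" using C1(1) b(1) by (simp add: C_def)
  moreover have "cmod (weyl_alternant \<Phi> \<mu> H)
       \<le> C * (\<Sum>w\<in>weyl_group \<Phi>. \<Prod>\<alpha>\<in>P. min 1 (root_dist \<alpha> H * \<bar>w \<mu> \<bullet> coroot \<alpha>\<bar>))"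
    if reg: "regular_integral \<Phi> \<mu>" for \<mu> H
  proof -
    have d0: "root_dist \<alpha> H \<ge> 0" for \<alpha> by (simp add: root_dist_def)
    obtain \<theta> where \<theta>: "\<eta> \<le> \<theta>" "\<theta> \<le> 1 / (1 + N)"
        "\<And>\<alpha>. \<alpha> \<in> \<Phi> \<Longrightarrow> root_dist \<alpha> H \<le> (1 + N) * \<theta> \<Longrightarrow> root_dist \<alpha> H \<le> \<theta>"
      using threshold_gap[OF finite_roots order_refl, of "1 + N" "\<lambda>\<alpha>. root_dist \<alpha> H"] N(1)
      unfolding \<eta>_def by auto
    define J where "J = {\<alpha> \<in> \<Phi>. root_dist \<alpha> H \<le> \<theta>}"
    have J: "J \<subseteq> \<Phi>" by (auto simp: J_def)
    have closedJ: "reflection_closed J" unfolding J_def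
      using N \<theta>(3) root_dist_subadditive
      by (intro subadditive_sublevel_closed[OF order_refl reflection_closed_roots, of _ N]) auto
    have "(2 + N) * \<theta> \<le> (2 + N) * (1 / (1 + N))" using \<theta>(2) N(1) by (intro mult_left_mono) auto
    also have "\<dots> < 2" using N(1) by (simp add: field_simps)
    finally have small: "(2 + N) * \<theta> < 2" .
    have NJ: "\<bar>\<beta> \<bullet> coroot \<alpha>\<bar> \<le> N" if "\<alpha> \<in> J" "\<beta> \<in> J" for \<alpha> \<beta>
      using N(2) J that by blast
    have "root_dist \<alpha> H \<le> \<theta>" if "\<alpha> \<in> J" for \<alpha> using that by (simp add: J_def)
    from lift_to_tangent_space[OF J closedJ NJ this small]
    obtain X where X: "\<forall>\<alpha>\<in>J. \<bar>\<alpha> \<bullet> X\<bar> \<le> pi * root_dist \<alpha> H"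
        "\<forall>\<alpha>\<in>J. \<exists>k::int. \<alpha> \<bullet> (H - X) = 2 * pi * of_int k"
      by blast
    define M where "M w = (\<Prod>\<alpha>\<in>P. min 1 (root_dist \<alpha> H * \<bar>w \<mu> \<bullet> coroot \<alpha>\<bar>))" for w
    have compare: "majorant J (w \<mu>) 0 X j \<le> b ^ card P * M (j \<circ> w)"
      if w: "w \<in> weyl_group \<Phi>" and j: "j \<in> weyl_group J" for w j
    proof -
      define \<nu> where "\<nu> = j (w \<mu>)"
      have "j \<circ> w \<in> weyl_group \<Phi>" using w j weyl_mono[OF J] weyl_comp by blast
      then have \<nu>: "regular_integral \<Phi> \<nu>" using regular_integral_weyl[OF reg] by (fastforce simp: \<nu>_def)
      have cp: "cmod (cpair \<alpha> (j (w \<mu>)) (j 0)) = \<bar>\<alpha> \<bullet> \<nu>\<bar>" for \<alpha>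
        using linear_0[OF weyl_linear[OF j]] by (simp add: cpair_def \<nu>_def cmod_def)
      have "majorant J (w \<mu>) 0 X j = (\<Prod>\<alpha>\<in>P. if \<alpha> \<in> J then min 1 (\<bar>\<alpha> \<bullet> X\<bar> * \<bar>\<alpha> \<bullet> \<nu>\<bar>) else 1)"
        unfolding majorant_def cp by (rule prod.mono_neutral_cong_left) (use finP in auto)
      also have "\<dots> \<le> (\<Prod>\<alpha>\<in>P. b * min 1 (root_dist \<alpha> H * \<bar>\<nu> \<bullet> coroot \<alpha>\<bar>))"
      proof (rule prod_mono, rule conjI)
        fix \<alpha> assume "\<alpha> \<in> P"
        then have \<alpha>: "\<alpha> \<in> \<Phi>" using PP by blast
        define y where "y = \<bar>\<nu> \<bullet> coroot \<alpha>\<bar>"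
        define d where "d = root_dist \<alpha> H"
        have "y \<ge> 0" "d \<ge> 0" by (auto simp: y_def d_def d0)
        have scale: "min 1 (b * (d * y)) \<le> b * min 1 (d * y)"
        proof (cases "d * y \<le> 1")
          case False
          then show ?thesis using b(1) by simp
        qed simp
        show "(if \<alpha> \<in> J then min 1 (\<bar>\<alpha> \<bullet> X\<bar> * \<bar>\<alpha> \<bullet> \<nu>\<bar>) else 1) \<le> b * min 1 (root_dist \<alpha> H * \<bar>\<nu> \<bullet> coroot \<alpha>\<bar>)"
        proof (cases "\<alpha> \<in> J")
          case True
          have "\<alpha> \<bullet> \<alpha> > 0" using \<alpha> zero_not_root by auto
          then have "\<bar>\<alpha> \<bullet> \<nu>\<bar> = \<bar>\<alpha> \<bullet> \<alpha>\<bar> / 2 * y"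
            by (simp add: y_def inner_coroot inner_commute abs_mult)
          also have "\<dots> \<le> N * y" using N(2)[OF \<alpha> \<alpha>] \<open>y \<ge> 0\<close> by (intro mult_right_mono) auto
          finally have "\<bar>\<alpha> \<bullet> X\<bar> * \<bar>\<alpha> \<bullet> \<nu>\<bar> \<le> (pi * d) * (N * y)"
            using X(1) True \<open>d \<ge> 0\<close> unfolding d_def by (intro mult_mono) auto
          also have "\<dots> = (pi * N) * (d * y)" by simp
          also have "\<dots> \<le> b * (d * y)" using b(2) \<open>y \<ge> 0\<close> \<open>d \<ge> 0\<close> by (intro mult_right_mono) auto
          finally have "min 1 (\<bar>\<alpha> \<bullet> X\<bar> * \<bar>\<alpha> \<bullet> \<nu>\<bar>) \<le> min 1 (b * (d * y))" by simp
          from order_trans[OF this scale] show ?thesis using True unfolding y_def d_def by (simp only: if_True)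
        next
          case False
          have "\<nu> \<bullet> coroot \<alpha> \<in> \<int> - {0}" using \<nu> \<alpha> by (simp add: regular_integral_def)
          then have "y \<ge> 1" unfolding y_def by (auto elim!: Ints_cases)
          moreover have "d \<ge> \<eta>" using False \<alpha> \<theta>(1) by (auto simp: J_def d_def)
          ultimately have "\<eta> * 1 \<le> d * y" using \<eta> by (intro mult_mono) auto
          then have "1 \<le> 1 / \<eta> * (d * y)" using \<eta> by (simp add: field_simps)
          also have "\<dots> \<le> b * (d * y)" using b(3) \<open>y \<ge> 0\<close> \<open>d \<ge> 0\<close> by (intro mult_right_mono) auto
          finally have "1 \<le> min 1 (b * (d * y))" by simp
          from order_trans[OF this scale] show ?thesis
            using False unfolding y_def d_def by (simp only: if_False)
        qed
      qed auto
      also have "\<dots> = b ^ card P * M (j \<circ> w)" by (simp add: prod.distrib M_def \<nu>_def)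
      finally show ?thesis .
    qed
    have "cmod (alternant \<Phi> \<mu> 0 H) \<le> (\<Sum>w\<in>weyl_group \<Phi>. C * M w)"
    proof (rule alternant_bound_by_double_cosets[OF finite_weyl[OF order_refl] J empty_subsetI])
      fix w assume w: "w \<in> weyl_group \<Phi>"
      have w0: "w 0 = 0" using linear_0[OF weyl_linear[OF w]] .
      have "cmod (alternant J (w \<mu>) 0 H) = cmod (alternant J (w \<mu>) 0 X)"
        using alternant_translate[OF J _ regular_integral_weyl[OF reg w], of "H - X" X] X(2) by simp
      also have "\<dots> \<le> C1 * (\<Sum>j\<in>weyl_group J. majorant J (w \<mu>) 0 X j)"
      proof -
        have "\<forall>j\<in>weyl_group J. \<bar>j 0 \<bullet> X\<bar> \<le> 0" using linear_0[OF weyl_linear] by force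
        then show ?thesis using C1(2)[OF J closedJ] unfolding euclidean_bound_def by blast
      qed
      also have "\<dots> \<le> (C1 + 1) * (\<Sum>j\<in>weyl_group J. b ^ card P * M (j \<circ> w))"
        using compare[OF w] C1(1) majorant_nonneg by (intro mult_mono sum_mono sum_nonneg) auto
      also have "\<dots> = (\<Sum>j\<in>weyl_group J. C * M (j \<circ> w))"
        by (simp add: C_def sum_distrib_left mult.assoc)
      finally show "cmod (\<Sum>k\<in>weyl_group {}. of_real (det (matrix k)) * alternant J (w (k \<mu>)) (w (k 0)) H)
          \<le> (\<Sum>k\<in>weyl_group {}. \<Sum>j\<in>weyl_group J. C * M (j \<circ> w \<circ> k))"
        by (simp add: weyl_group_empty w0 norm_mult abs_det_weyl[OF weyl_group.weyl_id])
    qed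
    then show ?thesis by (simp add: weyl_alternant_eq M_def sum_distrib_left)
  qed
  ultimately show ?thesis by blast
qed

end

theorem theorem1p4:
  fixes \<Phi> P :: "(real ^ 'n) set"
  assumes "root_system \<Phi>" and "positive_system \<Phi> P"
  shows "\<exists>C::real. C > 0 \<and>
    (\<forall>\<mu> H :: real ^ 'n. regular_integral \<Phi> \<mu> \<longrightarrow>
       cmod (weyl_alternant \<Phi> \<mu> H)
         \<le> C * (\<Sum>w\<in>weyl_group \<Phi>. \<Prod>\<alpha>\<in>P. min 1 (root_dist \<alpha> H * \<bar>w \<mu> \<bullet> coroot \<alpha>\<bar>)))"
proof -
  interpret positive_root_system \<Phi> P by unfold_locales (rule assms)+
  show ?thesis by (rule weyl_alternant_bound)
qed

end
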